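(* Let $K\neq\mathbb{Q}$ be a real number field. Then \[ \bigcap_{\zeta\in S\cap K}\mathscr{M}_{\zeta}=\mathbb{Z}\subsetneq\mathcal{O}_{K}\subset\bigcap_{\zeta\in S_{K}}\mathscr{M}_{\zeta}\subsetneq\bigcup_{\zeta\in S_{K}}\mathscr{M}_{\zeta}=\bigcup_{\zeta\in S\cap K}\mathscr{M}_{\zeta}=K. \]
   Context: A Pisot number is a real algebraic integer $\zeta>1$ all of whose conjugates other than $\zeta$ lie strictly inside the unit circle of $\mathbb{C}$; $S$ denotes the set of Pisot numbers and, for a number field $K$, $S_{K}$ denotes the set of Pisot numbers $\zeta$ with $\mathbb{Q}(\zeta)=K$. For real $\zeta>1$, $\mathscr{M}_{\zeta}$ denotes the set of all $\alpha\in\mathbb{R}$ with $\Vert\alpha\zeta^{n}\Vert\to0$ as $n\to\infty$, where $\Vert x\Vert$ is the distance from $x$ to the nearest integer. $\mathcal{O}_{K}$ is the ring of integers of $K$. *)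

theory Defs
  imports
    "HOL-Analysis.Analysis"
    "HOL-Algebra.Algebraic_Closure_Type"
    "HOL-Algebra.Embedded_Algebras"
    "HOL-Algebra.Generated_Fields"
begin

(* ring_of_type_algebra packages the type real as a HOL-Algebra ring with carrier UNIV;
   real number fields are its subfields of finite degree over the rationals. *)
abbreviation real_field :: "real ring" where
  "real_field \<equiv> ring_of_type_algebra"

definition real_number_field :: "real set \<Rightarrow> bool" where
  "real_number_field K \<longleftrightarrow> subfield K real_field \<and> ring.finite_dimension real_field \<rat> K"

definition ring_of_integers :: "real set \<Rightarrow> real set" where
  "ring_of_integers K = {x \<in> K. algebraic_int x}"

definition is_min_poly :: "rat poly \<Rightarrow> 'a :: field_char_0 \<Rightarrow> bool" where
  "is_min_poly p x \<longleftrightarrow>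
     Polynomial.lead_coeff p = 1 \<and> Factorial_Ring.irreducible p \<and> poly (map_poly of_rat p) x = 0"

(* Conjugates over the rationals: the complex roots of the minimal polynomial.  The existential
   quantifier ranges over at most one p, and exactly one if x is algebraic. *)
definition conjugates :: "real \<Rightarrow> complex set" where
  "conjugates x = {z. \<exists>p. is_min_poly p x \<and> poly (map_poly of_rat p) z = 0}"

definition Pisot :: "real set" where
  "Pisot = {\<zeta>. algebraic_int \<zeta> \<and> \<zeta> > 1 \<and>
              (\<forall>z \<in> conjugates \<zeta> - {complex_of_real \<zeta>}. norm z < 1)}"

(* generate_field closes under inverses and contains 1, so over a ring of characteristic 0 it
   contains the rationals: generate_field real_field {x} is the field obtained by adjoining x
   to the rationals. *)
definition Pisot_generators :: "real set \<Rightarrow> real set" where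
  "Pisot_generators K = {\<zeta> \<in> Pisot. generate_field real_field {\<zeta>} = K}"

definition nearest_int_dist :: "real \<Rightarrow> real" where
  "nearest_int_dist x = infdist x \<int>"

definition M_set :: "real \<Rightarrow> real set" where
  "M_set \<zeta> = {\<alpha>. (\<lambda>n::nat. nearest_int_dist (\<alpha> * \<zeta> ^ n)) \<longlonglongrightarrow> 0}"

end

theory Submission
  imports
    Defs
    "Jordan_Normal_Form.Char_Poly"
    "HOL-Analysis.Kronecker_Approximation_Theorem"
begin

text \<open>For a Pisot number \<open>\<zeta>\<close> and an algebraic integer \<open>\<alpha> = q(\<zeta>)\<close>, the trace of \<open>\<alpha> \<zeta> ^ n\<close> is an
  integer, and it differs from \<open>\<alpha> \<zeta> ^ n\<close> by a sum over the other conjugates, which tends to \<open>0\<close>.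
  Conversely, if \<open>\<alpha> \<zeta> ^ n\<close> approaches the integers, then the nearest integers eventually satisfy
  the linear recurrence of the powers of \<open>\<zeta>\<close>, which forces \<open>\<alpha>\<close> to lie in the field of \<open>\<zeta>\<close>.
  If \<open>\<alpha> \<in> K\<close> and \<open>N \<alpha>\<close> is an algebraic integer, then so is \<open>\<alpha> \<zeta>\<close> whenever \<open>\<zeta> = N \<eta>\<close> for an
  algebraic integer \<open>\<eta>\<close>; Pisot generators \<open>\<zeta>\<close> of \<open>K\<close> of this kind come from a primitive element
  by Dirichlet approximation. The Pisot numbers \<open>2\<close> and \<open>3\<close> already cut the first intersection down
  to the integers, and the traces of the powers of a Pisot generator rule out \<open>1 / N\<close> for a
  suitable \<open>N\<close>.\<close>

subsection \<open>Finitely generated modules\<close>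

text \<open>Coefficients pass through \<open>h\<close>, so one notion covers integral modules
  (\<open>of_int\<close>) and rational vector spaces (\<open>of_rat\<close>). The family
  \<open>v\<close> is a generating family, not a basis.\<close>

definition lin_span :: "('b \<Rightarrow> 'a) \<Rightarrow> 'i set \<Rightarrow> ('i \<Rightarrow> 'a) \<Rightarrow> 'a::comm_ring_1 set" where
  "lin_span h I v = range (\<lambda>c. \<Sum>i\<in>I. h (c i) * v i)"

lemma lin_spanI: "x = (\<Sum>i\<in>I. h (c i) * v i) \<Longrightarrow> x \<in> lin_span h I v"
  unfolding lin_span_def by blast

lemma lin_span_zero:
  assumes "comm_ring_hom h"
  shows "0 \<in> lin_span h I v"
proof -
  interpret comm_ring_hom h by fact
  show ?thesis
    by (rule lin_spanI[where c = "\<lambda>_. 0"]) simp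
qed

lemma lin_span_add:
  assumes "comm_ring_hom h" "x \<in> lin_span h I v" "y \<in> lin_span h I v"
  shows "x + y \<in> lin_span h I v"
proof -
  interpret comm_ring_hom h by fact
  obtain c d where "x = (\<Sum>i\<in>I. h (c i) * v i)" "y = (\<Sum>i\<in>I. h (d i) * v i)"
    using assms(2,3) unfolding lin_span_def by blast
  then have "x + y = (\<Sum>i\<in>I. h (c i + d i) * v i)"
    by (simp add: hom_add sum.distrib distrib_right)
  then show ?thesis
    by (rule lin_spanI)
qed

lemma lin_span_smult:
  assumes "comm_ring_hom h" "x \<in> lin_span h I v"
  shows "h r * x \<in> lin_span h I v"
proof -
  interpret comm_ring_hom h by fact
  obtain c where "x = (\<Sum>i\<in>I. h (c i) * v i)"
    using assms(2) unfolding lin_span_def by blast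
  then have "h r * x = (\<Sum>i\<in>I. h (r * c i) * v i)"
    by (simp add: hom_mult sum_distrib_left mult_ac)
  then show ?thesis
    by (rule lin_spanI)
qed

lemma lin_span_sum:
  assumes "comm_ring_hom h" "\<And>j. j \<in> J \<Longrightarrow> f j \<in> lin_span h I v"
  shows "(\<Sum>j\<in>J. f j) \<in> lin_span h I v"
  using assms(2)
  by (induction J rule: infinite_finite_induct)
     (auto intro: lin_span_zero lin_span_add assms(1))

lemma lin_span_base:
  assumes "comm_ring_hom h" "finite I" "i \<in> I"
  shows "v i \<in> lin_span h I v"
proof -
  interpret comm_ring_hom h by fact
  have "v i = (\<Sum>j\<in>I. h (if j = i then 1 else 0) * v j)"
    using assms(2,3) by (simp add: if_distrib[of h] if_distrib[of "\<lambda>x. x * _"] cong: if_cong)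
  then show ?thesis
    by (rule lin_spanI)
qed

lemma lin_span_mult_closed:
  assumes h: "comm_ring_hom h" and "\<And>i. i \<in> I \<Longrightarrow> x * v i \<in> lin_span h I v" and y: "y \<in> lin_span h I v"
  shows "x * y \<in> lin_span h I v"
proof -
  obtain c where y: "y = (\<Sum>i\<in>I. h (c i) * v i)"
    using y unfolding lin_span_def by blast
  have "x * y = (\<Sum>i\<in>I. h (c i) * (x * v i))"
    unfolding y by (simp add: sum_distrib_left mult_ac)
  also have "\<dots> \<in> lin_span h I v"
    by (intro lin_span_sum lin_span_smult h assms)
  finally show ?thesis .
qed

text \<open>The determinant trick: \<open>x\<close> is an eigenvalue of its multiplication matrix.\<close>

lemma root_of_stable_module:
  fixes x :: "'a :: field" and h :: "'b :: comm_ring_1 \<Rightarrow> 'a"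
  assumes h: "comm_ring_hom h" and fin: "finite I" and i0: "i0 \<in> I" "v i0 \<noteq> 0"
    and stable: "\<And>i. i \<in> I \<Longrightarrow> x * v i \<in> lin_span h I v"
  obtains p where "monic p" "poly (map_poly h p) x = 0"
proof -
  interpret comm_ring_hom h by fact
  define n where "n = card I"
  obtain f where f: "bij_betw f {0..<n} I"
    using ex_bij_betw_nat_finite[OF fin] n_def by blast
  have "\<exists>c. x * v i = (\<Sum>j\<in>I. h (c j) * v j)" if "i \<in> I" for i
    using stable[OF that] unfolding lin_span_def by blast
  then obtain c where c: "\<And>i. i \<in> I \<Longrightarrow> x * v i = (\<Sum>j\<in>I. h (c i j) * v j)"
    by metis
  define A where "A = Matrix.mat n n (\<lambda>(i, j). c (f i) (f j))"
  define w where "w = Matrix.vec n (\<lambda>i. v (f i))"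
  have A: "A \<in> carrier_mat n n"
    by (simp add: A_def)
  then have hA: "map_mat h A \<in> carrier_mat n n"
    by simp
  have "map_mat h A *\<^sub>v w = x \<cdot>\<^sub>v w"
  proof (rule eq_vecI)
    fix i assume "i < dim_vec (x \<cdot>\<^sub>v w)"
    then have i: "i < n" by (simp add: w_def)
    then have fi: "f i \<in> I" using f bij_betwE by fastforce
    have "vec_index (map_mat h A *\<^sub>v w) i = (\<Sum>j\<in>{0..<n}. h (c (f i) (f j)) * v (f j))"
      using i by (simp add: A_def w_def scalar_prod_def)
    also have "\<dots> = (\<Sum>j\<in>I. h (c (f i) j) * v j)"
      by (rule sum.reindex_bij_betw[OF f])
    also have "\<dots> = x * v (f i)"
      using c[OF fi] by simp
    finally show "vec_index (map_mat h A *\<^sub>v w) i = vec_index (x \<cdot>\<^sub>v w) i"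
      using i by (simp add: w_def)
  qed (simp add: A_def w_def)
  \<comment> \<open>One nonzero generator makes the vector of generators a genuine eigenvector, even
    when the generators are linearly dependent.\<close>
  moreover have "w \<noteq> 0\<^sub>v n"
  proof
    assume w: "w = 0\<^sub>v n"
    obtain k where k: "k < n" "f k = i0"
      using f i0(1) by (metis atLeastLessThan_iff bij_betw_def imageE)
    then have "vec_index w k = v i0" by (simp add: w_def)
    with w k i0(2) show False by simp
  qed
  ultimately have "eigenvalue (map_mat h A) x"
    unfolding eigenvalue_def eigenvector_def using A by (auto intro!: exI[of _ w] simp: w_def)
  then have "poly (char_poly (map_mat h A)) x = 0"
    using eigenvalue_root_char_poly[OF hA] by simp
  \<comment> \<open>Taking the characteristic polynomial before applying \<open>h\<close> gives a
    monic equation with coefficients in the source ring, hence an integral one for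
    \<open>of_int\<close>.\<close>
  then have "poly (map_poly h (char_poly A)) x = 0"
    using char_poly_hom[OF A] by simp
  moreover have "monic (char_poly A)"
    using degree_monic_char_poly[OF A] by simp
  ultimately show ?thesis
    using that by blast
qed

section \<open>Sums, products and polynomial values of algebraic integers\<close>

lemma monic_root_power:
  fixes a :: "'a :: comm_ring_1"
  assumes "monic p" "poly p a = 0"
  shows "a ^ Polynomial.degree p = (\<Sum>i<Polynomial.degree p. - poly.coeff p i * a ^ i)"
proof -
  have "0 = (\<Sum>i\<le>Polynomial.degree p. poly.coeff p i * a ^ i)"
    using assms(2) by (simp add: poly_altdef)
  also have "{..Polynomial.degree p} = insert (Polynomial.degree p) {..<Polynomial.degree p}"
    by auto
  finally show ?thesis
    using assms(1) by (simp add: sum_negf eq_neg_iff_add_eq_0)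
qed

lemma monic_root_degree_pos:
  fixes a :: "'a :: comm_ring_1"
  assumes "monic p" "poly p a = 0"
  shows "0 < Polynomial.degree p"
  using assms by (auto elim!: degree_eq_zeroE intro!: gr0I)

text \<open>The products \<open>a ^ i * b ^ j\<close> below the degrees of two integral equations
  generate a group stable under \<open>a\<close> and \<open>b\<close>, hence under
  \<open>a + b\<close> and \<open>a * b\<close>; the determinant trick applies to both.\<close>

lemma algebraic_int_combination:
  fixes a b :: "'a :: field_char_0"
  assumes "algebraic_int a" "algebraic_int b"
  shows "algebraic_int (a + b)" "algebraic_int (a * b)"
proof -
  interpret hi: comm_ring_hom "of_int :: int \<Rightarrow> 'a" by unfold_locales auto
  have h: "comm_ring_hom (of_int :: int \<Rightarrow> 'a)" by unfold_locales
  obtain p where p: "poly (map_poly of_int p) a = 0" "monic (map_poly of_int p :: 'a poly)"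
    using assms(1) unfolding algebraic_int_altdef_ipoly by (auto simp: degree_map_poly coeff_map_poly)
  obtain q where q: "poly (map_poly of_int q) b = 0" "monic (map_poly of_int q :: 'a poly)"
    using assms(2) unfolding algebraic_int_altdef_ipoly by (auto simp: degree_map_poly coeff_map_poly)
  define m where "m = Polynomial.degree (map_poly of_int p :: 'a poly)"
  define n where "n = Polynomial.degree (map_poly of_int q :: 'a poly)"
  have am: "a ^ m = (\<Sum>i<m. of_int (- poly.coeff p i) * a ^ i)"
    using monic_root_power[OF p(2,1)] by (simp add: m_def coeff_map_poly)
  have bn: "b ^ n = (\<Sum>j<n. of_int (- poly.coeff q j) * b ^ j)"
    using monic_root_power[OF q(2,1)] by (simp add: n_def coeff_map_poly)
  have pos: "0 < m" "0 < n"
    using monic_root_degree_pos[OF p(2,1)] monic_root_degree_pos[OF q(2,1)]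
    by (simp_all add: m_def n_def)
  define I where "I = {..<m} \<times> {..<n}"
  define v where "v = (\<lambda>(i, j). a ^ i * b ^ j)"
  let ?M = "lin_span of_int I v :: 'a set"
  have fin: "finite I" by (simp add: I_def)
  have base: "a ^ i * b ^ j \<in> ?M" if "i < m" "j < n" for i j
    using lin_span_base[OF h fin, of "(i, j)" v] that by (simp add: I_def v_def)
  have a_base: "a * v k \<in> ?M" if k: "k \<in> I" for k
  proof -
    obtain i j where ij: "k = (i, j)" "i < m" "j < n" using k by (auto simp: I_def)
    show ?thesis
    proof (cases "Suc i < m")
      case True
      then show ?thesis using base[of "Suc i" j] ij by (simp add: v_def mult_ac)
    next
      case False
      \<comment> \<open>The exponent has just reached \<open>m\<close>, and the equation of
        \<open>a\<close> folds \<open>a ^ m\<close> back into lower powers.\<close>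
      then have "Suc i = m" using ij by simp
      then have "a * v k = a ^ m * b ^ j" by (auto simp: ij v_def)
      also have "\<dots> = (\<Sum>i<m. of_int (- poly.coeff p i) * (a ^ i * b ^ j))"
        unfolding am by (simp add: sum_distrib_left sum_distrib_right mult_ac)
      also have "\<dots> \<in> ?M"
        using ij by (intro lin_span_sum lin_span_smult h base) auto
      finally show ?thesis .
    qed
  qed
  have b_base: "b * v k \<in> ?M" if k: "k \<in> I" for k
  proof -
    obtain i j where ij: "k = (i, j)" "i < m" "j < n" using k by (auto simp: I_def)
    show ?thesis
    proof (cases "Suc j < n")
      case True
      then show ?thesis using base[of i "Suc j"] ij by (simp add: v_def mult_ac)
    next
      case False
      then have "Suc j = n" using ij by simp
      then have "b * v k = a ^ i * b ^ n" by (auto simp: ij v_def)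
      also have "\<dots> = (\<Sum>j<n. of_int (- poly.coeff q j) * (a ^ i * b ^ j))"
        unfolding bn by (simp add: sum_distrib_left mult_ac)
      also have "\<dots> \<in> ?M"
        using ij by (intro lin_span_sum lin_span_smult h base) auto
      finally show ?thesis .
    qed
  qed
  have key: "algebraic_int x" if x: "\<And>k. k \<in> I \<Longrightarrow> x * v k \<in> ?M" for x
  proof -
    \<comment> \<open>The nonzero generator is the one at index \<open>(0, 0)\<close>, which equals
      \<open>1\<close>.\<close>
    obtain r where "monic r" "poly (map_poly of_int r) x = 0"
      using root_of_stable_module[OF h fin _ _ x, of "(0, 0)"] pos by (auto simp: I_def v_def)
    then show ?thesis
      unfolding algebraic_int_altdef_ipoly by blast
  qed
  show "algebraic_int (a + b)"
    by (rule key) (auto simp: distrib_right intro!: lin_span_add h a_base b_base)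
  show "algebraic_int (a * b)"
    by (rule key) (auto simp: mult.assoc intro!: lin_span_mult_closed h a_base b_base)
qed

lemmas algebraic_int_add = algebraic_int_combination(1)
lemmas algebraic_int_mult = algebraic_int_combination(2)

lemma algebraic_int_of_int: "algebraic_int (of_int k :: 'a :: field_char_0)"
  by (rule int_imp_algebraic_int) simp

lemma algebraic_int_of_nat: "algebraic_int (of_nat n :: 'a :: field_char_0)"
  by (rule int_imp_algebraic_int) simp

lemma algebraic_int_sum:
  fixes f :: "'i \<Rightarrow> 'a :: field_char_0"
  assumes "\<And>i. i \<in> A \<Longrightarrow> algebraic_int (f i)"
  shows "algebraic_int (\<Sum>i\<in>A. f i)"
  using assms
  by (induction A rule: infinite_finite_induct) (auto intro: algebraic_int_add)

lemma algebraic_int_power: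
  fixes x :: "'a :: field_char_0"
  assumes "algebraic_int x"
  shows "algebraic_int (x ^ n)"
  using assms by (induction n) (auto intro: algebraic_int_mult int_imp_algebraic_int)

lemma algebraic_int_poly:
  fixes x :: "'a :: field_char_0"
  assumes "\<And>i. poly.coeff p i \<in> \<int>" "algebraic_int x"
  shows "algebraic_int (poly p x)"
  unfolding poly_altdef
  by (intro algebraic_int_sum algebraic_int_mult algebraic_int_power assms int_imp_algebraic_int)

subsection \<open>Polynomials over the rationals\<close>

interpretation rat_poly_hom: map_poly_inj_idom_hom of_rat ..

interpretation of_real_poly_hom: map_poly_inj_idom_hom complex_of_real ..

abbreviation rpoly :: "rat poly \<Rightarrow> 'a :: field_char_0 \<Rightarrow> 'a" where
  "rpoly p x \<equiv> poly (map_poly of_rat p) x"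

lemma of_real_of_rat: "of_real (of_rat r) = (of_rat r :: complex)"
  by (cases r) (simp add: of_rat_rat)

lemma rpoly_of_real: "rpoly p (of_real x :: complex) = of_real (rpoly p x)"
  by (simp add: poly_altdef degree_map_poly coeff_map_poly of_real_of_rat)

lemma rpoly_add: "rpoly (p + q) x = rpoly p x + rpoly q x"
  and rpoly_diff: "rpoly (p - q) x = rpoly p x - rpoly q x"
  and rpoly_mult: "rpoly (p * q) x = rpoly p x * rpoly q x"
  and rpoly_uminus: "rpoly (- p) x = - rpoly p x"
  and rpoly_pcompose: "rpoly (pcompose p q) x = rpoly p (rpoly q x)"
  by (simp_all add: hom_distribs poly_pcompose)

lemma rpoly_X: "rpoly [:0, 1:] x = x"
  by (simp add: hom_distribs)

lemma rpoly_dvd: "p dvd q \<Longrightarrow> rpoly p x = 0 \<Longrightarrow> rpoly q x = 0"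
  by (auto simp: rpoly_mult elim!: dvdE)

text \<open>Otherwise \<open>p\<close> and \<open>f\<close> are coprime over the rationals, and a
  Bezout relation evaluated at the common root reads \<open>0 = 1\<close>.\<close>

lemma irreducible_rpoly_dvd:
  assumes "Factorial_Ring.irreducible p" "rpoly p x = 0" "rpoly f x = 0"
  shows "p dvd f"
proof (rule ccontr)
  assume "\<not> p dvd f"
  moreover have "prime_elem p"
    using assms(1) by (rule irreducible_imp_prime_elem_gcd)
  ultimately have "gcd p f = 1"
    using prime_elem_imp_coprime by (metis coprime_iff_gcd_eq_1)
  then obtain u w where "u * p + w * f = 1"
    using bezout_coefficients_fst_snd[of p f] by metis
  then have "rpoly (u * p + w * f) x = 1"
    by simp
  then show False
    by (simp add: rpoly_add rpoly_mult assms)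
qed

text \<open>Separability in characteristic zero: \<open>p\<close> would divide its derivative, which
  is nonzero of smaller degree.\<close>

lemma irreducible_rpoly_simple_root:
  fixes x :: "'a :: field_char_0"
  assumes "Factorial_Ring.irreducible p" "rpoly p x = 0"
  shows "rpoly (pderiv p) x \<noteq> 0"
proof
  assume "rpoly (pderiv p) x = 0"
  with assms have "p dvd pderiv p"
    by (rule irreducible_rpoly_dvd)
  moreover have "0 < Polynomial.degree p"
    using assms by (auto elim!: degree_eq_zeroE intro!: gr0I)
  ultimately show False
    using not_dvd_pderiv by blast
qed

text \<open>A nonzero annihilating polynomial of least degree, made monic, is irreducible: in any
  factorisation a factor vanishing at \<open>x\<close> already has full degree, so the cofactor is
  constant.\<close>

lemma ex_min_poly:
  fixes x :: "'a :: field_char_0"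
  assumes "p \<noteq> 0" "rpoly p x = 0"
  obtains m where "is_min_poly m x"
proof -
  define P where "P = (\<lambda>q. q \<noteq> 0 \<and> rpoly q x = 0)"
  have "P p" using assms by (simp add: P_def)
  from ex_has_least_nat[of P, OF this, of Polynomial.degree]
  obtain q where q: "P q" and least: "\<And>r. P r \<Longrightarrow> Polynomial.degree q \<le> Polynomial.degree r"
    by blast
  define m where "m = Polynomial.smult (inverse (Polynomial.lead_coeff q)) q"
  have m0: "m \<noteq> 0" and mroot: "rpoly m x = 0" and mdeg: "Polynomial.degree m = Polynomial.degree q"
    using q by (auto simp: P_def m_def hom_distribs)
  have "Polynomial.lead_coeff m = 1"
    using q by (simp add: P_def m_def)
  moreover have "Factorial_Ring.irreducible m"
  proof (rule Factorial_Ring.irreducibleI)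
    show "\<not> is_unit m"
    proof
      assume "is_unit m"
      then obtain r where "m * r = 1" by (metis dvdE)
      then have "rpoly (m * r) x = 1" by simp
      then show False by (simp add: rpoly_mult mroot)
    qed
  next
    have unit: "is_unit b" if "m = a * b" "rpoly a x = 0" for a b
    proof -
      have nz: "a \<noteq> 0" "b \<noteq> 0" using m0 that by auto
      then have "Polynomial.degree m = Polynomial.degree a + Polynomial.degree b"
        using that by (simp add: degree_mult_eq)
      moreover have "Polynomial.degree m \<le> Polynomial.degree a"
        unfolding mdeg by (rule least) (use nz that in \<open>simp add: P_def\<close>)
      ultimately show ?thesis using nz by (simp add: is_unit_iff_degree)
    qed
    fix a b assume ab: "m = a * b"
    then have "rpoly a x = 0 \<or> rpoly b x = 0"
      using mroot by (simp add: rpoly_mult)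
    then show "is_unit a \<or> is_unit b"
      using unit[of a b] unit[of b a] ab by (auto simp: mult.commute)
  qed (use m0 in simp)
  ultimately show ?thesis
    using that mroot by (simp add: is_min_poly_def)
qed

lemma algebraic_int_rpoly:
  fixes x :: "'a :: field_char_0"
  assumes "algebraic_int x"
  obtains p :: "int poly" where "monic p" "rpoly (map_poly of_int p) x = 0"
proof -
  obtain p :: "int poly" where "monic p" "poly (map_poly of_int p) x = 0"
    using assms unfolding algebraic_int_altdef_ipoly by blast
  moreover have "map_poly of_rat (map_poly of_int p) = (map_poly of_int p :: 'a poly)"
    by (simp add: map_poly_map_poly o_def)
  ultimately show ?thesis using that by simp
qed

lemma algebraic_int_ex_min_poly:
  fixes x :: "'a :: field_char_0"
  assumes "algebraic_int x"
  obtains m where "is_min_poly m x"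
proof -
  obtain p :: "int poly" where "monic p" "rpoly (map_poly of_int p) x = 0"
    using algebraic_int_rpoly[OF assms] .
  moreover from this have "map_poly of_int p \<noteq> (0 :: rat poly)"
    by (auto simp: map_poly_eq_0_iff)
  ultimately show ?thesis using that ex_min_poly by blast
qed

lemma is_min_poly_of_real:
  "is_min_poly p (of_real x :: complex) \<longleftrightarrow> is_min_poly p x"
  unfolding is_min_poly_def rpoly_of_real by simp

lemma is_min_poly_dvd: "is_min_poly m x \<Longrightarrow> rpoly f x = 0 \<Longrightarrow> m dvd f"
  unfolding is_min_poly_def using irreducible_rpoly_dvd by blast

text \<open>The minimal polynomial divides every integral equation of \<open>x\<close>, so
  \<open>y\<close> satisfies the same equation.\<close>

lemma algebraic_int_conjugate:
  assumes "is_min_poly m x" "algebraic_int x" "rpoly m y = 0"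
  shows "algebraic_int y"
proof -
  obtain p :: "int poly" where p: "monic p" "rpoly (map_poly of_int p) x = 0"
    using algebraic_int_rpoly[OF assms(2)] .
  have "rpoly (map_poly of_int p) y = 0"
    using rpoly_dvd[OF is_min_poly_dvd[OF assms(1) p(2)] assms(3)] .
  then have "poly (map_poly of_int p) y = 0"
    by (simp add: map_poly_map_poly o_def)
  with p(1) show ?thesis
    unfolding algebraic_int_altdef_ipoly by blast
qed

text \<open>Lagrange interpolation at the roots of \<open>p\<close>: the sum is the coefficient of degree
  \<open>deg p - 1\<close> of the remainder of \<open>f p'\<close> modulo \<open>p\<close>.\<close>

lemma sum_conjugates_rational:
  fixes p f :: "rat poly"
  assumes monic: "monic p" and irr: "Factorial_Ring.irreducible p"
  defines "R \<equiv> {z :: complex. rpoly p z = 0}"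
  shows "card R = Polynomial.degree p" "(\<Sum>z\<in>R. rpoly f z) \<in> \<rat>"
proof -
  define P :: "complex poly" where "P = map_poly of_rat p"
  have P0: "P \<noteq> 0" using monic by (auto simp: P_def)
  have finR: "finite R" unfolding R_def using poly_roots_finite[OF P0] by (simp add: P_def)
  \<comment> \<open>Separability makes \<open>P\<close> the product of \<open>X - z\<close> over its
    distinct roots.\<close>
  have "rsquarefree P"
    unfolding rsquarefree_roots P_def
    using irreducible_rpoly_simple_root[OF irr] by (auto simp: hom_distribs)
  then have P: "P = (\<Prod>z\<in>R. [:-z, 1:])"
    using complex_poly_decompose_rsquarefree[of P] monic by (simp add: R_def P_def)
  then have "Polynomial.degree P = card R"
    by (simp add: degree_prod_sum_eq)
  then show card: "card R = Polynomial.degree p"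
    by (simp add: P_def)
  define d where "d = card R"
  have "Polynomial.degree p > 0"
    using irr monic by (auto elim!: degree_eq_zeroE intro!: gr0I simp: is_unit_const_poly_iff)
  then have d: "d > 0" "Polynomial.degree p = d"
    by (simp_all add: d_def card)
  define r where "r = (f * pderiv p) mod p"
  define H :: "complex poly" where "H = (\<Sum>z\<in>R. Polynomial.smult (rpoly f z) (\<Prod>w\<in>R - {z}. [:-w, 1:]))"
  have "r = 0 \<or> Polynomial.degree r < d"
    unfolding r_def d(2)[symmetric] using degree_mod_less[of p] P0 by (auto simp: P_def)
  then have r_deg: "Polynomial.degree r < d" using d by auto
  have term_deg: "Polynomial.degree (\<Prod>w\<in>R - {z}. [:-w, 1:]) = d - 1" if "z \<in> R" for z
    using finR that by (simp add: degree_prod_sum_eq d_def)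
  have "Polynomial.degree H \<le> d - 1"
    unfolding H_def using term_deg
    by (intro degree_sum_le finR) (auto intro: order_trans[OF degree_smult_le])
  then have H_deg: "Polynomial.degree H < d" using d by simp
  \<comment> \<open>At a root \<open>w\<close> both sides equal \<open>f(w) P'(w)\<close>: the
    multiple of \<open>p\<close> drops out of the remainder, and only the summand
    \<open>z = w\<close> survives in \<open>H\<close> and in the derivative.\<close>
  have "poly (map_poly of_rat r) w = poly H w" if w: "w \<in> R" for w
  proof -
    have "f * pderiv p = p * ((f * pderiv p) div p) + r"
      unfolding r_def by simp
    then have "rpoly (f * pderiv p) w = rpoly (p * ((f * pderiv p) div p) + r) w"
      by simp
    then have "rpoly r w = rpoly f w * rpoly (pderiv p) w"
      using w by (simp add: rpoly_add rpoly_mult R_def)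
    also have "rpoly (pderiv p) w = poly (pderiv P) w"
      by (simp add: P_def hom_distribs)
    also have "\<dots> = (\<Sum>z\<in>R. \<Prod>u\<in>R - {z}. w - u)"
      unfolding P pderiv_prod by (simp add: poly_sum poly_prod pderiv_pCons)
    also have "\<dots> = (\<Sum>z\<in>R. if z = w then \<Prod>u\<in>R - {w}. w - u else 0)"
      using finR w by (intro sum.cong refl) (auto intro!: prod_zero)
    also have "\<dots> = (\<Prod>u\<in>R - {w}. w - u)"
      using finR w by simp
    also have "rpoly f w * \<dots> = (\<Sum>z\<in>R. if z = w then rpoly f w * (\<Prod>u\<in>R - {w}. w - u) else 0)"
      using finR w by simp
    also have "\<dots> = (\<Sum>z\<in>R. rpoly f z * (\<Prod>u\<in>R - {z}. w - u))"
      using finR w by (intro sum.cong refl) (auto intro!: prod_zero)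
    also have "\<dots> = poly H w"
      by (simp add: H_def poly_sum poly_prod)
    finally show ?thesis .
  qed
  then have "map_poly of_rat r = H"
    by (rule poly_eqI_degree[of R]) (use r_deg H_deg in \<open>simp_all add: d_def\<close>)
  \<comment> \<open>The products in \<open>H\<close> are monic of degree \<open>d - 1\<close>, so
    its coefficient there is the sum over the conjugates; on the side of \<open>r\<close> it is
    visibly rational.\<close>
  then have "of_rat (poly.coeff r (d - 1)) = poly.coeff H (d - 1)"
    by (metis coeff_map_poly of_rat_0)
  also have "\<dots> = (\<Sum>z\<in>R. rpoly f z * poly.coeff (\<Prod>w\<in>R - {z}. [:-w, 1:]) (d - 1))"
    by (simp add: H_def coeff_sum)
  also have "\<dots> = (\<Sum>z\<in>R. rpoly f z)"
  proof (intro sum.cong refl)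
    fix z assume "z \<in> R"
    then have "poly.coeff (\<Prod>w\<in>R - {z}. [:-w, 1:]) (d - 1)
        = Polynomial.lead_coeff (\<Prod>w\<in>R - {z}. [:-w, 1:])"
      using term_deg by simp
    then show "rpoly f z * poly.coeff (\<Prod>w\<in>R - {z}. [:-w, 1:]) (d - 1) = rpoly f z"
      by (simp add: lead_coeff_prod)
  qed
  finally show "(\<Sum>z\<in>R. rpoly f z) \<in> \<rat>"
    by (metis Rats_of_rat)
qed

subsection \<open>Subfields of the reals\<close>

lemma real_field_simps:
  "carrier real_field = UNIV" "x \<otimes>\<^bsub>real_field\<^esub> y = x * y" "x \<oplus>\<^bsub>real_field\<^esub> y = x + y"
  "\<zero>\<^bsub>real_field\<^esub> = 0" "\<one>\<^bsub>real_field\<^esub> = 1"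
  by (simp_all add: ring_of_type_algebra_def)

lemma field_real_field: "field real_field"
  by (rule field_from_type_algebra)

lemma real_field_a_inv: "\<ominus>\<^bsub>real_field\<^esub> x = - x"
proof -
  interpret R: field real_field by (rule field_real_field)
  show ?thesis
    using R.minus_equality[of "- x" x] by (simp add: real_field_simps)
qed

lemma real_field_m_inv: "x \<noteq> 0 \<Longrightarrow> inv\<^bsub>real_field\<^esub> x = inverse x"
proof -
  interpret R: field real_field by (rule field_real_field)
  show "x \<noteq> 0 \<Longrightarrow> inv\<^bsub>real_field\<^esub> x = inverse x"
    using R.comm_inv_char[of x "inverse x"] by (simp add: real_field_simps)
qed

context
  fixes F :: "real set"
  assumes F: "subfield F real_field"
begin

lemma subfield_one: "1 \<in> F"
  using subringE(3)[OF subfieldE(1)[OF F]] by (simp add: real_field_simps)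

lemma subfield_zero: "0 \<in> F"
  using subringE(2)[OF subfieldE(1)[OF F]] by (simp add: real_field_simps)

lemma subfield_uminus: "x \<in> F \<Longrightarrow> - x \<in> F"
  using subringE(5)[OF subfieldE(1)[OF F], of x] by (simp add: real_field_simps real_field_a_inv)

lemma subfield_add: "x \<in> F \<Longrightarrow> y \<in> F \<Longrightarrow> x + y \<in> F"
  using subringE(7)[OF subfieldE(1)[OF F], of x y] by (simp add: real_field_simps)

lemma subfield_mult: "x \<in> F \<Longrightarrow> y \<in> F \<Longrightarrow> x * y \<in> F"
  using subringE(6)[OF subfieldE(1)[OF F], of x y] by (simp add: real_field_simps)

lemma subfield_diff: "x \<in> F \<Longrightarrow> y \<in> F \<Longrightarrow> x - y \<in> F"
  using subfield_add[of x "- y"] subfield_uminus[of y] by simp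

lemma subfield_inverse: "x \<in> F \<Longrightarrow> inverse x \<in> F"
proof (cases "x = 0")
  case False
  interpret R: field real_field by (rule field_real_field)
  assume "x \<in> F"
  with False show ?thesis
    using R.subfield_m_inv(1)[OF F, of x] by (simp add: real_field_simps real_field_m_inv)
qed simp

lemma subfield_divide: "x \<in> F \<Longrightarrow> y \<in> F \<Longrightarrow> x / y \<in> F"
  unfolding divide_inverse by (intro subfield_mult subfield_inverse)

lemma subfield_of_nat: "of_nat n \<in> F"
  by (induction n) (auto intro: subfield_zero subfield_one subfield_add)

lemma subfield_of_int: "of_int k \<in> F"
  by (cases k) (auto intro: subfield_of_nat subfield_uminus simp del: of_nat_Suc)

lemma subfield_of_rat: "of_rat r \<in> F"
  by (cases r) (simp add: of_rat_rat subfield_divide subfield_of_int)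

lemma subfield_power: "x \<in> F \<Longrightarrow> x ^ n \<in> F"
  by (induction n) (auto intro: subfield_one subfield_mult)

lemma subfield_sum: "(\<And>i. i \<in> A \<Longrightarrow> f i \<in> F) \<Longrightarrow> (\<Sum>i\<in>A. f i) \<in> F"
  by (induction A rule: infinite_finite_induct) (auto intro: subfield_zero subfield_add)

lemma subfield_rpoly: "x \<in> F \<Longrightarrow> rpoly p x \<in> F"
  unfolding poly_altdef
  by (intro subfield_sum subfield_mult subfield_power) (auto simp: coeff_map_poly subfield_of_rat)

lemma subfield_poly: "(\<And>i. poly.coeff p i \<in> F) \<Longrightarrow> x \<in> F \<Longrightarrow> poly p x \<in> F"
  unfolding poly_altdef
  by (intro subfield_sum subfield_mult subfield_power) auto

text \<open>\<open>b\<close> is the only root of the greatest common divisor of \<open>p\<close> and \<open>q\<close>, and it is simple,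
  so this divisor is \<open>X - b\<close>; it has coefficients in \<open>F\<close>.\<close>

lemma unique_common_root_in_subfield:
  fixes p q :: "real poly"
  assumes pF: "\<And>i. poly.coeff p i \<in> F" and qF: "\<And>i. poly.coeff q i \<in> F"
    and p: "poly p b = 0" and q: "poly q b = 0" and simple: "poly (pderiv p) b \<noteq> 0"
    and unique: "\<And>z. poly (map_poly complex_of_real p) z = 0 \<Longrightarrow>
      poly (map_poly complex_of_real q) z = 0 \<Longrightarrow> z = of_real b"
  shows "b \<in> F"
proof -
  \<comment> \<open>The common divisor is found as a nonzero polynomial over \<open>F\<close> of
    least degree vanishing at \<open>b\<close>; up to a constant it is the minimal polynomial of
    \<open>b\<close> over \<open>F\<close>.\<close>
  define P where "P = (\<lambda>r. r \<noteq> 0 \<and> (\<forall>i. poly.coeff r i \<in> F) \<and> poly r b = 0)"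
  have "P p" using simple pF p by (auto simp: P_def)
  from ex_has_least_nat[of P, OF this, of Polynomial.degree]
  obtain r where r: "P r" and least: "\<And>s. P s \<Longrightarrow> Polynomial.degree r \<le> Polynomial.degree s"
    by blast
  have r0: "r \<noteq> 0" and rF: "\<And>i. poly.coeff r i \<in> F" and rb: "poly r b = 0"
    using r by (auto simp: P_def)
  have dvd: "r dvd f" if "\<And>i. poly.coeff f i \<in> F" "poly f b = 0" for f
    using that
  proof (induction "Polynomial.degree f" arbitrary: f rule: less_induct)
    case (less f)
    show ?case
    proof (cases "f = 0")
      case False
      then have "P f" using less.prems by (simp add: P_def)
      then have deg: "Polynomial.degree r \<le> Polynomial.degree f" by (rule least)
      \<comment> \<open>One step of long division: subtracting \<open>c X^k r\<close> cancels the
        leading term and stays over \<open>F\<close>.\<close>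
      define c where "c = Polynomial.lead_coeff f / Polynomial.lead_coeff r"
      define k where "k = Polynomial.degree f - Polynomial.degree r"
      define g where "g = f - Polynomial.monom c k * r"
      have cF: "c \<in> F" unfolding c_def by (intro subfield_divide less.prems rF)
      have c0: "c \<noteq> 0" using False r0 by (simp add: c_def)
      have gF: "poly.coeff g i \<in> F" for i
        unfolding g_def
        by (auto simp: coeff_monom_mult intro!: subfield_diff subfield_mult cF rF less.prems
            subfield_zero)
      have gb: "poly g b = 0" using less.prems rb by (simp add: g_def)
      have deg_eq: "Polynomial.degree (Polynomial.monom c k * r) = Polynomial.degree f"
        using c0 r0 deg by (simp add: degree_mult_eq degree_monom_eq k_def)
      have lc: "poly.coeff g (Polynomial.degree f) = 0"
        using deg r0 by (simp add: g_def coeff_monom_mult k_def c_def)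
      have "r dvd g"
      proof (cases "g = 0")
        case False
        have "Polynomial.degree g \<le> Polynomial.degree f"
          unfolding g_def using deg_eq by (intro degree_diff_le) auto
        moreover have "Polynomial.degree g \<noteq> Polynomial.degree f"
          using lc False by (metis leading_coeff_0_iff)
        ultimately show ?thesis
          using less.hyps gF gb by (metis le_neq_implies_less)
      qed simp
      then have "r dvd g + Polynomial.monom c k * r" by simp
      then show ?thesis by (simp add: g_def)
    qed simp
  qed
  have rp: "r dvd p" and rq: "r dvd q"
    using dvd pF qF p q by blast+
  have root: "z = of_real b" if "poly (map_poly complex_of_real r) z = 0" for z
  proof (rule unique)
    show "poly (map_poly complex_of_real p) z = 0" "poly (map_poly complex_of_real q) z = 0"
      using rp rq that by (auto elim!: dvdE simp: hom_distribs)
  qed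
  obtain s where s: "r = [:-b, 1:] * s"
    using rb by (auto simp: poly_eq_0_iff_dvd)
  \<comment> \<open>A nonconstant cofactor has a complex root, which can only be \<open>b\<close>;
    then \<open>b\<close> is a double root of \<open>r\<close> and hence of
    \<open>p\<close>.\<close>
  have "Polynomial.degree s = 0"
  proof (rule ccontr)
    assume "Polynomial.degree s \<noteq> 0"
    then have "\<not> constant (poly (map_poly complex_of_real s))"
      by (simp add: constant_degree)
    then obtain z where z: "poly (map_poly complex_of_real s) z = 0"
      using fundamental_theorem_of_algebra by blast
    then have "z = of_real b"
      by (intro root) (simp add: s hom_distribs)
    with z have "poly s b = 0"
      using of_real_hom.poly_map_poly[of s b, where ?'a = complex] by simp
    define l where "l = [:-b, 1:]"
    have "l * l dvd r"
      unfolding s using \<open>poly s b = 0\<close>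
      by (intro mult_dvd_mono) (auto simp: poly_eq_0_iff_dvd l_def)
    with rp obtain t where "p = l * l * t"
      by (meson dvd_trans dvdE)
    moreover have "poly l b = 0" by (simp add: l_def)
    ultimately have "poly (pderiv p) b = 0"
      by (simp add: pderiv_mult)
    with simple show False by simp
  qed
  then obtain c where c: "s = [:c:]"
    by (auto elim: degree_eq_zeroE)
  have "r = [:- (b * c), c:]" by (simp add: s c)
  then have "c \<noteq> 0" "c \<in> F" "- (b * c) \<in> F"
    using r0 rF[of 0] rF[of 1] by auto
  then have "b * c / c \<in> F"
    using subfield_uminus[of "- (b * c)"] by (intro subfield_divide) auto
  then show ?thesis using \<open>c \<noteq> 0\<close> by simp
qed

end

text \<open>The polynomial values at \<open>x\<close> already form a field: when \<open>s(x)\<close>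
  is nonzero, a Bezout relation between \<open>m\<close> and \<open>s\<close> exhibits its inverse
  as a polynomial value.\<close>

lemma generate_field_rpoly:
  fixes x :: real
  assumes x: "is_min_poly m x"
  shows "generate_field real_field {x} = range (\<lambda>s. rpoly s x)"
proof
  interpret R: field real_field by (rule field_real_field)
  have sub: "subfield (generate_field real_field {x}) real_field"
    by (rule R.generate_field_is_subfield) (simp add: real_field_simps)
  show "range (\<lambda>s. rpoly s x) \<subseteq> generate_field real_field {x}"
    using subfield_rpoly[OF sub] by (auto intro: generate_field.incl)
  show "generate_field real_field {x} \<subseteq> range (\<lambda>s. rpoly s x)"
  proof
    fix y assume "y \<in> generate_field real_field {x}"
    then show "y \<in> range (\<lambda>s. rpoly s x)"
    proof (induction rule: generate_field.induct)
      case one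
      show ?case by (rule range_eqI[of _ _ 1]) (simp add: real_field_simps)
    next
      case (incl h)
      then show ?case by (intro range_eqI[of _ _ "[:0, 1:]"]) (simp add: hom_distribs)
    next
      case (a_inv h)
      then obtain s where "h = rpoly s x" by blast
      then show ?case
        by (intro range_eqI[of _ _ "- s"]) (simp add: rpoly_uminus real_field_a_inv)
    next
      case (m_inv h)
      then obtain s where s: "h = rpoly s x" "h \<noteq> 0"
        by (auto simp: real_field_simps)
      have "\<not> m dvd s"
        using x s rpoly_dvd[of m s x] by (auto simp: is_min_poly_def)
      moreover have "prime_elem m"
        using x irreducible_imp_prime_elem_gcd by (auto simp: is_min_poly_def)
      ultimately have "gcd m s = 1"
        using prime_elem_imp_coprime by (metis coprime_iff_gcd_eq_1)
      then obtain u w where "u * m + w * s = 1"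
        using bezout_coefficients_fst_snd[of m s] by metis
      then have "rpoly (u * m + w * s) x = 1" by simp
      then have "rpoly w x * h = 1"
        using x by (simp add: rpoly_add rpoly_mult s is_min_poly_def)
      then have "inverse h = rpoly w x"
        by (metis inverse_unique mult.commute)
      then show ?case
        using s by (simp add: real_field_m_inv)
    next
      case (eng_add h1 h2)
      then obtain s t where "h1 = rpoly s x" "h2 = rpoly t x" by blast
      then show ?case
        by (intro range_eqI[of _ _ "s + t"]) (simp add: rpoly_add real_field_simps)
    next
      case (eng_mult h1 h2)
      then obtain s t where "h1 = rpoly s x" "h2 = rpoly t x" by blast
      then show ?case
        by (intro range_eqI[of _ _ "s * t"]) (simp add: rpoly_mult real_field_simps)
    qed
  qed
qed

lemma subfield_adjoin: "subfield (generate_field real_field {x}) real_field"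
proof -
  interpret R: field real_field by (rule field_real_field)
  show ?thesis
    by (rule R.generate_field_is_subfield) (simp add: real_field_simps)
qed

lemma adjoin_least:
  assumes "subfield F real_field" "x \<in> F"
  shows "generate_field real_field {x} \<subseteq> F"
proof -
  interpret R: field real_field by (rule field_real_field)
  show ?thesis
    using assms by (intro R.generate_field_min_subfield1) (auto simp: real_field_simps)
qed

subsection \<open>Primitive elements\<close>

text \<open>For suitable \<open>n\<close> and \<open>t = a + n b\<close>, the polynomials
  \<open>g(X)\<close> and \<open>f(t - n X)\<close> have \<open>b\<close> as their only common root,
  so \<open>b\<close> lies in every field containing \<open>t\<close>. Quantifying over all
  \<open>F\<close> makes the result easy to iterate.\<close>

lemma primitive_element_two:
  fixes a b :: real
  assumes "algebraic_int a" "algebraic_int b"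
  obtains n :: nat where
    "\<And>F. subfield F real_field \<Longrightarrow> a + of_nat n * b \<in> F \<Longrightarrow> a \<in> F \<and> b \<in> F"
proof -
  obtain f where f: "is_min_poly f a"
    using algebraic_int_ex_min_poly[OF assms(1)] .
  obtain g where g: "is_min_poly g b"
    using algebraic_int_ex_min_poly[OF assms(2)] .
  have f0: "map_poly of_rat f \<noteq> (0 :: complex poly)" and g0: "map_poly of_rat g \<noteq> (0 :: complex poly)"
    using f g by (auto simp: is_min_poly_def)
  \<comment> \<open>If conjugates \<open>z\<close> of \<open>a\<close> and \<open>w\<close> of
    \<open>b\<close> satisfy \<open>z + n w = a + n b\<close> with \<open>w\<close> different from
    \<open>b\<close>, then \<open>n\<close> is this quotient. Pairs with \<open>w = b\<close> only
    contribute the default value \<open>0\<close> of division by zero.\<close>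
  define bad where "bad = (\<lambda>(z, w). (z - of_real a) / (of_real b - w)) `
    ({z :: complex. rpoly f z = 0} \<times> {w :: complex. rpoly g w = 0})"
  have "finite bad"
    unfolding bad_def using poly_roots_finite[OF f0] poly_roots_finite[OF g0] by simp
  then have "finite {n :: nat. of_nat n \<in> bad}"
    using finite_vimageI[of bad "of_nat :: nat \<Rightarrow> complex"] by (simp add: vimage_def inj_of_nat)
  then obtain n :: nat where n: "of_nat n \<notin> bad"
    using infinite_UNIV_nat by (metis (mono_tags) UNIV_eq_I mem_Collect_eq)
  show ?thesis
  proof (rule that)
    fix F assume F: "subfield F real_field" and nF: "a + of_nat n * b \<in> F"
    define t where "t = a + of_nat n * b"
    have bF: "b \<in> F"
    proof (rule unique_common_root_in_subfield[OF F])
      let ?p = "map_poly of_rat g :: real poly"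
      let ?q = "pcompose (map_poly of_rat f) [:t, - of_nat n:] :: real poly"
      show "poly.coeff ?p i \<in> F" for i
        by (simp add: coeff_map_poly subfield_of_rat[OF F])
      have "poly.coeff [:t, - of_nat n:] i \<in> F" for i
        using nF F
        by (auto simp: coeff_pCons t_def split: nat.splits
            intro: subfield_uminus subfield_of_nat subfield_zero)
      then show "poly.coeff ?q i \<in> F" for i
        by (intro coeff_pcompose_semiring_closed)
           (auto simp: coeff_map_poly intro: subfield_of_rat subfield_zero subfield_one
             subfield_add subfield_mult F)
      show "poly ?p b = 0" "poly ?q b = 0"
        using f g by (simp_all add: is_min_poly_def poly_pcompose t_def)
      show "poly (pderiv ?p) b \<noteq> 0"
        using irreducible_rpoly_simple_root[of g b] g by (simp add: is_min_poly_def hom_distribs)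
      fix z assume "poly (map_poly complex_of_real ?p) z = 0" "poly (map_poly complex_of_real ?q) z = 0"
      then have z: "rpoly g z = 0" "rpoly f (of_real t - of_nat n * z) = 0"
        by (simp_all add: hom_distribs map_poly_map_poly o_def of_real_of_rat poly_pcompose mult_ac)
      show "z = of_real b"
      proof (rule ccontr)
        assume "z \<noteq> of_real b"
        then have "of_nat n = (of_real t - of_nat n * z - of_real a) / (of_real b - z)"
          by (simp add: t_def field_simps)
        also have "\<dots> \<in> bad"
          unfolding bad_def using z by (intro image_eqI[of _ _ "(of_real t - of_nat n * z, z)"]) auto
        finally show False using n by simp
      qed
    qed
    moreover have "a = t - of_nat n * b" by (simp add: t_def)
    ultimately show "a \<in> F \<and> b \<in> F"
      using nF F by (metis subfield_diff subfield_mult subfield_of_nat t_def)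
  qed
qed

lemma primitive_element_finite:
  assumes "finite V" "subfield K real_field" "\<And>v. v \<in> V \<Longrightarrow> v \<in> K \<and> algebraic_int v"
  obtains t where "t \<in> K" "algebraic_int t"
    "\<And>F. subfield F real_field \<Longrightarrow> t \<in> F \<Longrightarrow> V \<subseteq> F"
proof -
  have "\<exists>t \<in> K. algebraic_int t \<and> (\<forall>F. subfield F real_field \<longrightarrow> t \<in> F \<longrightarrow> V \<subseteq> F)"
    using assms(1,3)
  proof (induction V)
    case empty
    show ?case by (intro bexI[of _ 0] subfield_zero[OF assms(2)]) auto
  next
    case (insert v V)
    then obtain t where t: "t \<in> K" "algebraic_int t" "\<And>F. subfield F real_field \<Longrightarrow> t \<in> F \<Longrightarrow> V \<subseteq> F"
      by auto
    obtain n :: nat where n: "\<And>F. subfield F real_field \<Longrightarrow> t + of_nat n * v \<in> F \<Longrightarrow> t \<in> F \<and> v \<in> F"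
      using primitive_element_two[OF t(2), of v] insert.prems by auto
    have "t + of_nat n * v \<in> K"
      using insert.prems t(1) assms(2) by (auto intro: subfield_add subfield_mult subfield_of_nat)
    moreover have "algebraic_int (t + of_nat n * v)"
      using insert.prems t(2)
      by (auto intro!: algebraic_int_add algebraic_int_mult algebraic_int_of_nat)
    ultimately show ?case
      using n t(3) by (intro bexI[of _ "t + of_nat n * v"]) auto
  qed
  then show ?thesis using that by blast
qed

section \<open>Clearing denominators in rational coefficients and algebraic numbers\<close>

lemma common_denominator:
  assumes "finite A"
  obtains N :: nat where "0 < N" "\<And>r. r \<in> A \<Longrightarrow> of_nat N * r \<in> (\<int> :: rat set)"
proof -
  have "\<exists>N :: nat. 0 < N \<and> (\<forall>r \<in> A. of_nat N * r \<in> (\<int> :: rat set))"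
    using assms
  proof (induction A)
    case empty
    show ?case by (intro exI[of _ 1]) auto
  next
    case (insert r A)
    then obtain N :: nat where N: "0 < N" "\<And>r. r \<in> A \<Longrightarrow> of_nat N * r \<in> \<int>" by blast
    obtain p q :: int where pq: "r = of_int p / of_int q" "0 < q"
      by (metis quotient_of_denom_pos quotient_of_div surj_pair)
    have "of_nat (N * nat q) * r = of_int (int N * p)"
      using pq by (simp add: field_simps)
    then have "of_nat (N * nat q) * r \<in> \<int>"
      by (metis Ints_of_int)
    moreover have "of_nat (N * nat q) * s \<in> \<int>" if "s \<in> A" for s
    proof -
      have "of_nat (nat q) * (of_nat N * s) \<in> \<int>"
        by (rule Ints_mult[OF _ N(2)[OF that]]) simp
      moreover have "of_nat (nat q) * (of_nat N * s) = of_nat (N * nat q) * s"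
        by (simp only: of_nat_mult mult_ac)
      ultimately show ?thesis by simp
    qed
    ultimately show ?case
      using N(1) pq by (intro exI[of _ "N * nat q"]) (auto simp del: of_nat_mult)
  qed
  then show ?thesis using that by blast
qed

lemma common_denominator_poly:
  fixes p :: "rat poly"
  obtains N :: nat where "0 < N" "\<And>i. of_nat N * poly.coeff p i \<in> \<int>"
proof -
  obtain N where N: "0 < N" "\<And>r. r \<in> poly.coeff p ` {..Polynomial.degree p} \<Longrightarrow> of_nat N * r \<in> \<int>"
    using common_denominator[of "poly.coeff p ` {..Polynomial.degree p}"] by blast
  have "of_nat N * poly.coeff p i \<in> \<int>" for i
    using N(2)[of "poly.coeff p i"] by (cases "i \<le> Polynomial.degree p") (auto simp: coeff_eq_0)
  with N(1) show ?thesis using that by blast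
qed

text \<open>If \<open>N\<close> clears the denominators of a monic equation for \<open>x\<close>, then \<open>N x\<close> stabilises the
  group generated by the powers \<open>x ^ i\<close> with \<open>i < deg p\<close>.\<close>

lemma multiple_algebraic_int:
  fixes x :: real
  assumes p: "monic p" "rpoly p x = 0"
  obtains N :: nat where "0 < N" "algebraic_int (of_nat N * x)"
proof -
  define d where "d = Polynomial.degree p"
  have "finite (poly.coeff p ` {..<d})" by simp
  then obtain N where N: "0 < N" "\<And>i. i < d \<Longrightarrow> of_nat N * poly.coeff p i \<in> \<int>"
    using common_denominator by (metis image_eqI lessThan_iff)
  have mp: "monic (map_poly of_rat p :: real poly)" using p(1) by simp
  have d: "0 < d"
    using monic_root_degree_pos[OF mp p(2)] by (simp add: d_def)
  interpret hi: comm_ring_hom "of_int :: int \<Rightarrow> real" by unfold_locales auto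
  have h: "comm_ring_hom (of_int :: int \<Rightarrow> real)" by unfold_locales
  let ?M = "lin_span of_int {..<d} (\<lambda>i. x ^ i) :: real set"
  have "\<exists>k :: int. of_nat N * of_rat (poly.coeff p i) = (of_int k :: real)" if i: "i < d" for i
  proof -
    obtain k where "of_nat N * poly.coeff p i = of_int k"
      using N(2)[OF i] by (auto elim: Ints_cases)
    then have "of_rat (of_nat N * poly.coeff p i) = (of_int k :: real)" by simp
    then show ?thesis by (auto simp: of_rat_mult)
  qed
  then obtain k :: "nat \<Rightarrow> int" where
    k: "\<And>i. i < d \<Longrightarrow> of_nat N * of_rat (poly.coeff p i) = (of_int (k i) :: real)" by metis
  have stable: "of_nat N * x * x ^ i \<in> ?M" if "i \<in> {..<d}" for i
  proof (cases "Suc i < d")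
    case True
    have "of_int (int N) * x ^ Suc i \<in> ?M"
      using True by (intro lin_span_smult h lin_span_base) auto
    then show ?thesis by (simp add: mult_ac)
  next
    case False
    with that have i: "Suc i = d" by simp
    then have "of_nat N * x * x ^ i = of_nat N * x ^ d" by auto
    also have "\<dots> = (\<Sum>j<d. of_int (- k j) * x ^ j)"
      using monic_root_power[OF mp p(2)]
      by (simp add: d_def sum_distrib_left k[symmetric] mult_ac coeff_map_poly)
    also have "\<dots> \<in> ?M" by (rule lin_spanI[OF refl])
    finally show ?thesis .
  qed
  obtain r where "monic r" "poly (map_poly of_int r) (of_nat N * x) = 0"
    using root_of_stable_module[OF h _ _ _ stable, of 0] d by auto
  then have "algebraic_int (of_nat N * x)"
    unfolding algebraic_int_altdef_ipoly by blast
  with N(1) show ?thesis using that by blast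
qed

text \<open>Unwinds the inductive definition of dimension: each line extension contributes one more
  generator, stored at index \<open>n\<close>.\<close>

lemma real_number_field_span:
  assumes "real_number_field K"
  obtains n :: nat and v where "K = lin_span of_rat {..<n} v"
proof -
  interpret R: field real_field by (rule field_real_field)
  obtain d where "R.dimension d \<rat> K"
    using assms by (auto simp: real_number_field_def R.finite_dimension_def)
  then have "\<exists>(n :: nat) v. K = lin_span of_rat {..<n} v"
  proof (induction d "\<rat> :: real set" K rule: R.dimension.induct)
    case zero_dim
    show ?case
      by (intro exI[of _ 0]) (simp add: lin_span_def real_field_simps)
  next
    case (Suc_dim w E d)
    then obtain n :: nat and v where E: "E = lin_span of_rat {..<n} v" by blast
    have "R.line_extension \<rat> w E = lin_span of_rat {..<Suc n} (v(n := w))"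
    proof (intro equalityI subsetI)
      fix u assume "u \<in> R.line_extension \<rat> w E"
      then obtain k e where ke: "k \<in> \<rat>" "e \<in> E" "u = k * w + e"
        by (auto simp: R.line_extension_mem_iff real_field_simps)
      obtain r where r: "k = of_rat r" using ke by (auto elim: Rats_cases)
      obtain c where c: "e = (\<Sum>i<n. of_rat (c i) * v i)"
        using ke(2) unfolding E lin_span_def by blast
      have "u = (\<Sum>i<Suc n. of_rat ((c(n := r)) i) * (v(n := w)) i)"
        using ke(3) by (simp add: r c)
      then show "u \<in> lin_span of_rat {..<Suc n} (v(n := w))"
        by (rule lin_spanI)
    next
      fix u assume "u \<in> lin_span of_rat {..<Suc n} (v(n := w))"
      then obtain c where "u = (\<Sum>i<Suc n. of_rat (c i) * (v(n := w)) i)"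
        unfolding lin_span_def by blast
      then have "u = of_rat (c n) * w + (\<Sum>i<n. of_rat (c i) * v i)" by simp
      moreover have "(\<Sum>i<n. of_rat (c i) * v i) \<in> E"
        unfolding E lin_span_def by blast
      ultimately show "u \<in> R.line_extension \<rat> w E"
        by (auto simp: R.line_extension_mem_iff real_field_simps)
    qed
    then show ?case by blast
  qed
  then show ?thesis using that by blast
qed

text \<open>Multiplication by \<open>x\<close> preserves the finite rational span \<open>K\<close>,
  so the determinant trick gives a monic rational equation, whose denominators are then
  cleared.\<close>

lemma real_number_field_multiple_algebraic_int:
  assumes "real_number_field K" "x \<in> K"
  obtains N :: nat where "0 < N" "algebraic_int (of_nat N * x)"
proof -
  have K: "subfield K real_field" using assms(1) by (simp add: real_number_field_def)
  interpret hr: comm_ring_hom "of_rat :: rat \<Rightarrow> real" by unfold_locales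
  have h: "comm_ring_hom (of_rat :: rat \<Rightarrow> real)" by unfold_locales
  obtain n :: nat and v where v: "K = lin_span of_rat {..<n} v"
    using real_number_field_span[OF assms(1)] .
  have stable: "x * v i \<in> lin_span of_rat {..<n} v" if "i \<in> {..<n}" for i
    using subfield_mult[OF K assms(2), of "v i"] lin_span_base[OF h _ that, of v] by (simp add: v)
  have "\<exists>i \<in> {..<n}. v i \<noteq> 0"
  proof (rule ccontr)
    assume "\<not> (\<exists>i \<in> {..<n}. v i \<noteq> 0)"
    then have "K \<subseteq> {0}" unfolding v lin_span_def by auto
    then show False using subfield_one[OF K] by auto
  qed
  then obtain i where "i \<in> {..<n}" "v i \<noteq> 0" by blast
  then obtain p where "monic p" "rpoly p x = 0"
    using root_of_stable_module[OF h _ _ _ stable] by blast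
  then show ?thesis
    using multiple_algebraic_int that by blast
qed

text \<open>The rational generators of \<open>K\<close> are scaled to algebraic integers, captured
  in the field of a single element \<open>t\<close>, and recovered there by dividing by the scaling
  factors.\<close>

lemma real_number_field_primitive_element:
  assumes "real_number_field K"
  obtains t where "algebraic_int t" "generate_field real_field {t} = K"
proof -
  have K: "subfield K real_field" using assms by (simp add: real_number_field_def)
  have h: "comm_ring_hom (of_rat :: rat \<Rightarrow> real)" ..
  obtain n :: nat and v where v: "K = lin_span of_rat {..<n} v"
    using real_number_field_span[OF assms] .
  have vK: "v i \<in> K" if "i < n" for i
    unfolding v using that by (intro lin_span_base h) auto
  have "\<exists>N :: nat. 0 < N \<and> algebraic_int (of_nat N * v i)" if "i < n" for i
    using real_number_field_multiple_algebraic_int[OF assms vK[OF that]] by blast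
  then obtain N :: "nat \<Rightarrow> nat" where N: "\<And>i. i < n \<Longrightarrow> 0 < N i \<and> algebraic_int (of_nat (N i) * v i)"
    by metis
  define V where "V = (\<lambda>i. of_nat (N i) * v i) ` {..<n}"
  have "finite V" by (simp add: V_def)
  moreover have "x \<in> K \<and> algebraic_int x" if "x \<in> V" for x
    using that N vK by (auto simp: V_def intro!: subfield_mult subfield_of_nat K)
  ultimately obtain t where t: "t \<in> K" "algebraic_int t"
    "\<And>F. subfield F real_field \<Longrightarrow> t \<in> F \<Longrightarrow> V \<subseteq> F"
    using primitive_element_finite[OF _ K] by blast
  let ?F = "generate_field real_field {t}"
  have F: "subfield ?F real_field" by (rule subfield_adjoin)
  have VF: "V \<subseteq> ?F"
    by (rule t(3)[OF F]) (simp add: generate_field.incl)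
  have vF: "v i \<in> ?F" if "i < n" for i
  proof -
    have "of_nat (N i) * v i \<in> ?F" using VF that by (auto simp: V_def)
    then have "of_nat (N i) * v i / of_nat (N i) \<in> ?F"
      by (intro subfield_divide[OF F] subfield_of_nat[OF F])
    then show ?thesis using N[OF that] by simp
  qed
  have "K \<subseteq> ?F"
    unfolding v lin_span_def
    by (auto intro!: subfield_sum[OF F] subfield_mult[OF F] subfield_of_rat[OF F] vF)
  moreover have "?F \<subseteq> K" by (rule adjoin_least[OF K t(1)])
  ultimately show ?thesis using that t(2) by blast
qed

subsection \<open>Distance to the nearest integer\<close>

text \<open>The integers are closed, so the distance is attained and \<open>s n\<close> can be a
  nearest integer; conversely any integer sequence bounds the distance from above.\<close>

lemma M_set_iff:
  "\<alpha> \<in> M_set \<zeta> \<longleftrightarrow> (\<exists>s :: nat \<Rightarrow> int. (\<lambda>n. \<alpha> * \<zeta> ^ n - of_int (s n)) \<longlonglongrightarrow> 0)"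
proof
  assume "\<alpha> \<in> M_set \<zeta>"
  then have lim: "(\<lambda>n. nearest_int_dist (\<alpha> * \<zeta> ^ n)) \<longlonglongrightarrow> 0" by (simp add: M_set_def)
  have "\<exists>k :: int. nearest_int_dist x = \<bar>x - of_int k\<bar>" for x
  proof -
    obtain a where "a \<in> \<int>" "infdist x \<int> = dist x a"
      using infdist_attains_inf[of "\<int> :: real set" x] by (metis closed_Ints Ints_0 empty_iff)
    then show ?thesis by (auto simp: nearest_int_dist_def dist_real_def elim!: Ints_cases)
  qed
  then obtain s where s: "\<And>x. nearest_int_dist x = \<bar>x - of_int (s x)\<bar>" by metis
  have "(\<lambda>n. \<alpha> * \<zeta> ^ n - of_int (s (\<alpha> * \<zeta> ^ n))) \<longlonglongrightarrow> 0"
    using lim unfolding s by (simp add: tendsto_rabs_zero_iff)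
  then show "\<exists>s :: nat \<Rightarrow> int. (\<lambda>n. \<alpha> * \<zeta> ^ n - of_int (s n)) \<longlonglongrightarrow> 0"
    by (intro exI[of _ "\<lambda>n. s (\<alpha> * \<zeta> ^ n)"])
next
  assume "\<exists>s :: nat \<Rightarrow> int. (\<lambda>n. \<alpha> * \<zeta> ^ n - of_int (s n)) \<longlonglongrightarrow> 0"
  then obtain s :: "nat \<Rightarrow> int" where s: "(\<lambda>n. \<alpha> * \<zeta> ^ n - of_int (s n)) \<longlonglongrightarrow> 0" ..
  have "nearest_int_dist x \<ge> 0" "nearest_int_dist x \<le> \<bar>x - of_int k\<bar>" for x and k :: int
    using infdist_le[of "of_int k" \<int> x]
    by (simp_all add: nearest_int_dist_def infdist_nonneg dist_real_def)
  then have "(\<lambda>n. nearest_int_dist (\<alpha> * \<zeta> ^ n)) \<longlonglongrightarrow> 0"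
    using tendsto_sandwich[OF _ _ tendsto_const tendsto_rabs_zero[OF s]] by simp
  then show "\<alpha> \<in> M_set \<zeta>" by (simp add: M_set_def)
qed

text \<open>Multiplying by \<open>\<zeta>\<close> shifts the sequence by one place, and its limit
  depends only on the tail.\<close>

lemma M_set_shift:
  assumes "\<alpha> * \<zeta> \<in> M_set \<zeta>"
  shows "\<alpha> \<in> M_set \<zeta>"
proof -
  have "(\<lambda>n. nearest_int_dist (\<alpha> * \<zeta> ^ Suc n)) \<longlonglongrightarrow> 0"
    using assms by (simp add: M_set_def mult_ac)
  then show ?thesis
    unfolding M_set_def by (auto intro: LIMSEQ_imp_Suc)
qed

lemma int_sequence_tendsto_zero:
  fixes s :: "nat \<Rightarrow> int"
  assumes "(\<lambda>n. real_of_int (s n)) \<longlonglongrightarrow> 0"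
  shows "\<forall>\<^sub>F n in sequentially. s n = 0"
proof -
  have "\<forall>\<^sub>F n in sequentially. dist (real_of_int (s n)) 0 < 1"
    using assms by (rule tendstoD) simp
  then show ?thesis by eventually_elim auto
qed

subsection \<open>Traces of powers of a Pisot number\<close>

lemma Pisot_min_poly:
  assumes "\<zeta> \<in> Pisot"
  obtains m where "is_min_poly m \<zeta>"
    "\<And>z :: complex. rpoly m z = 0 \<Longrightarrow> z \<noteq> of_real \<zeta> \<Longrightarrow> norm z < 1"
proof -
  obtain m where m: "is_min_poly m \<zeta>"
    using assms algebraic_int_ex_min_poly by (auto simp: Pisot_def)
  then have "norm z < 1" if "rpoly m z = 0" "z \<noteq> of_real \<zeta>" for z :: complex
    using assms that by (auto simp: Pisot_def conjugates_def)
  with m show ?thesis using that by blast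
qed

text \<open>The sum is the trace of \<open>q(x) x^n\<close>. It is rational by
  \<open>sum_conjugates_rational\<close> and an algebraic integer because every \<open>z\<close> and
  every \<open>q(z)\<close> is one.\<close>

lemma trace_int:
  fixes x :: real
  assumes m: "is_min_poly m x" and x: "algebraic_int x" and a: "algebraic_int (rpoly q x)"
  shows "(\<Sum>z | rpoly m z = 0. rpoly q z * z ^ n) \<in> (\<int> :: complex set)"
proof (rule rational_algebraic_int_is_int)
  let ?R = "{z :: complex. rpoly m z = 0}"
  have "(\<Sum>z\<in>?R. rpoly (q * Polynomial.monom 1 n) z) \<in> \<rat>"
    using m by (intro sum_conjugates_rational(2)) (auto simp: is_min_poly_def)
  then show "(\<Sum>z\<in>?R. rpoly q z * z ^ n) \<in> \<rat>"
    by (simp add: rpoly_mult poly_monom hom_distribs)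
  obtain ma where ma: "is_min_poly ma (rpoly q x)"
    using algebraic_int_ex_min_poly[OF a] .
  \<comment> \<open>The relation \<open>ma(q(X)) = 0\<close> at \<open>x\<close> passes to every
    conjugate \<open>z\<close>, which makes \<open>q(z)\<close> a conjugate of
    \<open>q(x)\<close>.\<close>
  then have "rpoly (pcompose ma q) x = 0"
    by (simp add: rpoly_pcompose is_min_poly_def)
  then have dvd: "m dvd pcompose ma q"
    by (rule is_min_poly_dvd[OF m])
  have "algebraic_int (rpoly q z)" if "z \<in> ?R" for z :: complex
  proof -
    have "rpoly ma (rpoly q z) = 0"
      using rpoly_dvd[OF dvd, of z] that by (simp add: rpoly_pcompose)
    then show ?thesis
      using algebraic_int_conjugate[of ma "of_real (rpoly q x) :: complex"] ma a
      by (simp add: is_min_poly_of_real)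
  qed
  moreover have "algebraic_int z" if "z \<in> ?R" for z :: complex
    using algebraic_int_conjugate[of m "of_real x :: complex" z] m x that
    by (simp add: is_min_poly_of_real)
  ultimately show "algebraic_int (\<Sum>z\<in>?R. rpoly q z * z ^ n)"
    by (intro algebraic_int_sum algebraic_int_mult algebraic_int_power) auto
qed

lemma trace_asymptotic:
  fixes m q :: "rat poly" and s :: "nat \<Rightarrow> int"
  assumes m: "is_min_poly m \<zeta>"
    and conj: "\<And>z :: complex. rpoly m z = 0 \<Longrightarrow> z \<noteq> of_real \<zeta> \<Longrightarrow> norm z < 1"
    and s: "\<And>n. (\<Sum>z | rpoly m z = 0. rpoly q z * z ^ n) = (of_int (s n) :: complex)"
  shows "(\<lambda>n. rpoly q \<zeta> * \<zeta> ^ n - of_int (s n)) \<longlonglongrightarrow> 0"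
proof -
  let ?R = "{z :: complex. rpoly m z = 0}"
  have "map_poly of_rat m \<noteq> (0 :: complex poly)" using m by (auto simp: is_min_poly_def)
  then have fin: "finite ?R" by (rule poly_roots_finite)
  have mem: "of_real \<zeta> \<in> ?R" using m by (simp add: rpoly_of_real is_min_poly_def)
  have "(\<lambda>n. - (\<Sum>z\<in>?R - {of_real \<zeta>}. rpoly q z * z ^ n)) \<longlonglongrightarrow> - (\<Sum>z\<in>?R - {of_real \<zeta>}. rpoly q z * 0)"
    using conj by (intro tendsto_intros LIMSEQ_power_zero) auto
  moreover have "- (\<Sum>z\<in>?R - {of_real \<zeta>}. rpoly q z * z ^ n)
      = of_real (rpoly q \<zeta> * \<zeta> ^ n - of_int (s n))" for n
    using s[of n] sum.remove[OF fin mem, of "\<lambda>z. rpoly q z * z ^ n"]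
    by (simp add: rpoly_of_real algebra_simps)
  ultimately have "(\<lambda>n. complex_of_real (rpoly q \<zeta> * \<zeta> ^ n - of_int (s n))) \<longlonglongrightarrow> of_real 0"
    by simp
  then show ?thesis by (simp only: tendsto_of_real_iff)
qed

lemma Pisot_algebraic_int_in_M_set:
  assumes "\<zeta> \<in> Pisot" "\<alpha> \<in> generate_field real_field {\<zeta>}" "algebraic_int \<alpha>"
  shows "\<alpha> \<in> M_set \<zeta>"
proof -
  obtain m where m: "is_min_poly m \<zeta>"
    "\<And>z :: complex. rpoly m z = 0 \<Longrightarrow> z \<noteq> of_real \<zeta> \<Longrightarrow> norm z < 1"
    using Pisot_min_poly[OF assms(1)] by blast
  obtain q where q: "\<alpha> = rpoly q \<zeta>"
    using assms(2) generate_field_rpoly[OF m(1)] by auto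
  have "(\<Sum>z | rpoly m z = 0. rpoly q z * z ^ n) \<in> (\<int> :: complex set)" for n
    using assms q by (intro trace_int[OF m(1)]) (auto simp: Pisot_def)
  then have "\<exists>k :: int. (\<Sum>z | rpoly m z = 0. rpoly q z * z ^ n) = (of_int k :: complex)" for n
    by (meson Ints_cases)
  then obtain s :: "nat \<Rightarrow> int" where
    "\<And>n. (\<Sum>z | rpoly m z = 0. rpoly q z * z ^ n) = (of_int (s n) :: complex)" by metis
  from trace_asymptotic[OF m this] show ?thesis
    unfolding M_set_iff q by blast
qed

text \<open>If \<open>1 / N\<close> were in the set, then \<open>N\<close> would divide all traces of high powers of \<open>\<zeta>\<close>. As
  \<open>N\<close> is prime to the constant coefficient of the recurrence of the traces, it would divide the
  trace \<open>d\<close> of \<open>1\<close>.\<close>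

lemma Pisot_inverse_nat_not_in_M_set:
  assumes "\<zeta> \<in> Pisot"
  obtains N :: nat where "0 < N" "1 / of_nat N \<notin> M_set \<zeta>"
proof -
  obtain m where m: "is_min_poly m \<zeta>"
    "\<And>z :: complex. rpoly m z = 0 \<Longrightarrow> z \<noteq> of_real \<zeta> \<Longrightarrow> norm z < 1"
    using Pisot_min_poly[OF assms] by blast
  have ai: "algebraic_int \<zeta>" and gt1: "\<zeta> > 1" using assms by (auto simp: Pisot_def)
  let ?R = "{z :: complex. rpoly m z = 0}"
  define d where "d = card ?R"
  have mP: "monic m" "Factorial_Ring.irreducible m" using m(1) by (auto simp: is_min_poly_def)
  have "map_poly of_rat m \<noteq> (0 :: complex poly)" using mP by auto
  then have fin: "finite ?R" by (rule poly_roots_finite)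
  have "of_real \<zeta> \<in> ?R" using m by (simp add: rpoly_of_real is_min_poly_def)
  then have d: "0 < d" using fin by (auto simp: d_def card_gt_0_iff)
  \<comment> \<open>With \<open>q = 1\<close> the traces are the power sums of the
    conjugates.\<close>
  have "(\<Sum>z\<in>?R. rpoly 1 z * z ^ n) \<in> (\<int> :: complex set)" for n
    by (intro trace_int[OF m(1) ai]) auto
  then have "\<exists>k :: int. (\<Sum>z\<in>?R. rpoly 1 z * z ^ n) = (of_int k :: complex)" for n
    by (meson Ints_cases)
  then obtain t :: "nat \<Rightarrow> int" where t:
    "\<And>n. (\<Sum>z\<in>?R. rpoly 1 z * z ^ n) = (of_int (t n) :: complex)" by metis
  have t_lim: "(\<lambda>n. \<zeta> ^ n - of_int (t n)) \<longlonglongrightarrow> 0"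
    using trace_asymptotic[OF m t] by simp
  have "of_int (t 0) = (of_int (int d) :: complex)"
    using t[of 0] by (simp add: d_def)
  then have t0: "t 0 = int d" by (simp only: of_int_eq_iff)

  \<comment> \<open>Least degree among monic integral equations forces a nonzero constant
    coefficient: as \<open>\<zeta>\<close> is nonzero, a factor \<open>X\<close> could be
    cancelled.\<close>
  define P where "P = (\<lambda>p :: int poly. monic p \<and> rpoly (map_poly of_int p) \<zeta> = 0)"
  obtain p0 where "P p0" using algebraic_int_rpoly[OF ai] by (auto simp: P_def)
  from ex_has_least_nat[of P, OF this, of Polynomial.degree]
  obtain p where p: "P p" and least: "\<And>r. P r \<Longrightarrow> Polynomial.degree p \<le> Polynomial.degree r"
    by blast
  have c0: "poly.coeff p 0 \<noteq> 0"
  proof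
    assume c: "poly.coeff p 0 = 0"
    obtain r where r: "p = pCons 0 r" using c by (cases p) auto
    then have "r \<noteq> 0" using p by (auto simp: P_def)
    then have "P r" using p r gt1 by (auto simp: P_def hom_distribs)
    from least[OF this] show False using r \<open>r \<noteq> 0\<close> by simp
  qed
  have rec: "(\<Sum>i\<le>Polynomial.degree p. poly.coeff p i * t (n + i)) = 0" for n
  proof -
    have root: "rpoly (map_poly of_int p) z = 0" if "z \<in> ?R" for z :: complex
      using rpoly_dvd[OF is_min_poly_dvd[OF m(1)], of "map_poly of_int p" z] p that
      by (simp add: P_def)
    have "of_int (\<Sum>i\<le>Polynomial.degree p. poly.coeff p i * t (n + i))
        = (\<Sum>i\<le>Polynomial.degree p. of_int (poly.coeff p i) * (\<Sum>z\<in>?R. rpoly 1 z * z ^ (n + i)))"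
      by (simp only: t of_int_sum of_int_mult)
    also have "\<dots> = (\<Sum>z\<in>?R. \<Sum>i\<le>Polynomial.degree p. of_int (poly.coeff p i) * z ^ (n + i))"
      by (simp add: sum_distrib_left sum.swap[of _ ?R])
    also have "\<dots> = (\<Sum>z\<in>?R. z ^ n * rpoly (map_poly of_int p) z)"
      by (simp add: poly_altdef sum_distrib_left map_poly_map_poly o_def coeff_map_poly
          power_add mult_ac)
    also have "\<dots> = 0" using root by simp
    finally show ?thesis by (simp only: of_int_eq_0_iff)
  qed

  \<comment> \<open>This is \<open>1\<close> modulo the constant coefficient, hence coprime to it,
    and exceeds \<open>d\<close>.\<close>
  define N where "N = d * nat \<bar>poly.coeff p 0\<bar> + 1"
  have N0: "0 < N" by (simp add: N_def)
  have "1 / of_nat N \<notin> M_set \<zeta>"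
  proof
    assume "1 / of_nat N \<in> M_set \<zeta>"
    then obtain s :: "nat \<Rightarrow> int" where s: "(\<lambda>n. 1 / of_nat N * \<zeta> ^ n - of_int (s n)) \<longlonglongrightarrow> 0"
      unfolding M_set_iff by blast
    \<comment> \<open>The two errors combine to the integer \<open>t n - N * s n\<close>, which
      tends to \<open>0\<close> and so is eventually \<open>0\<close>.\<close>
    have "(\<lambda>n. of_nat N * (1 / of_nat N * \<zeta> ^ n - of_int (s n)) - (\<zeta> ^ n - of_int (t n)))
        \<longlonglongrightarrow> of_nat N * 0 - 0"
      by (intro tendsto_intros s t_lim)
    moreover have "of_nat N * (1 / of_nat N * \<zeta> ^ n - of_int (s n)) - (\<zeta> ^ n - of_int (t n))
        = real_of_int (t n - int N * s n)" for n
      using N0 by (simp add: right_diff_distrib)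
    ultimately have "(\<lambda>n. real_of_int (t n - int N * s n)) \<longlonglongrightarrow> 0"
      by (simp only: mult_zero_right diff_zero)
    from int_sequence_tendsto_zero[OF this]
    obtain n0 where n0: "\<And>n. n \<ge> n0 \<Longrightarrow> int N dvd t n"
      unfolding eventually_sequentially by (metis dvd_triv_left eq_iff_diff_eq_0)
    have cop: "Rings.coprime (int N) (poly.coeff p 0)"
    proof (rule coprimeI)
      fix c :: int assume c: "c dvd int N" "c dvd poly.coeff p 0"
      then have "c dvd int N - int d * \<bar>poly.coeff p 0\<bar>" by simp
      then show "is_unit c" by (simp add: N_def)
    qed
    \<comment> \<open>Descent from \<open>n0\<close> to \<open>0\<close>: \<open>k\<close> counts
      the steps down, truncated at index \<open>0\<close>, and \<open>i\<close> keeps the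
      divisibility for all later indices available to the recurrence.\<close>
    have "int N dvd t (n0 - k + i)" for k i
    proof (induction k arbitrary: i)
      case 0
      then show ?case using n0 by simp
    next
      case (Suc k)
      show ?case
      proof (cases "n0 \<le> k")
        case True
        then show ?thesis using Suc[of i] by simp
      next
        case False
        define j where "j = n0 - Suc k"
        have j: "n0 - k = Suc j" using False by (simp add: j_def)
        have dvd: "int N dvd t (j + Suc i)" for i
          using Suc[of i] unfolding j by simp
        \<comment> \<open>The recurrence is solved backwards for its lowest term; coprimality
          removes the constant coefficient.\<close>
        have "{..Polynomial.degree p} = insert 0 {1..Polynomial.degree p}" by auto
        with rec[of j] have "poly.coeff p 0 * t j = - (\<Sum>i=1..Polynomial.degree p. poly.coeff p i * t (j + i))"
          by simp
        moreover have "int N dvd (\<Sum>i=1..Polynomial.degree p. poly.coeff p i * t (j + i))"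
        proof (intro dvd_sum dvd_mult)
          fix i assume "i \<in> {1..Polynomial.degree p}"
          then show "int N dvd t (j + i)" using dvd[of "i - 1"] by simp
        qed
        ultimately have "int N dvd poly.coeff p 0 * t j" by simp
        then have "int N dvd t j"
          using cop by (simp add: coprime_dvd_mult_right_iff)
        then show ?thesis
          using dvd[of "i - 1"] by (cases i) (simp_all add: j_def)
      qed
    qed
    from this[of n0 0] have "int N dvd int d" by (simp add: t0)
    then have "N \<le> d" using d by (simp add: dvd_imp_le)
    moreover have "1 \<le> nat \<bar>poly.coeff p 0\<bar>" using c0 by simp
    then have "d * 1 \<le> d * nat \<bar>poly.coeff p 0\<bar>" by (intro mult_le_mono) auto
    ultimately show False by (simp add: N_def)
  qed
  with N0 show ?thesis using that by blast
qed

subsection \<open>Pisot's theorem for algebraic numbers\<close>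

text \<open>The nearest integers \<open>s n\<close> to \<open>\<alpha> \<zeta> ^ n\<close> eventually satisfy the linear recurrence with
  characteristic polynomial \<open>p = (X - \<zeta>) g\<close>. Hence \<open>u n = \<Sum>i. g\<^sub>i s (n + i)\<close> is eventually
  geometric of ratio \<open>\<zeta>\<close>, while it is asymptotic to \<open>\<alpha> \<zeta> ^ n g(\<zeta>)\<close>.\<close>

lemma M_set_subset_adjoin:
  assumes ai: "algebraic_int \<zeta>" and gt1: "\<zeta> > 1"
  shows "M_set \<zeta> \<subseteq> generate_field real_field {\<zeta>}"
proof
  fix \<alpha> assume "\<alpha> \<in> M_set \<zeta>"
  then obtain s :: "nat \<Rightarrow> int" where s: "(\<lambda>n. \<alpha> * \<zeta> ^ n - of_int (s n)) \<longlonglongrightarrow> 0"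
    unfolding M_set_iff by blast
  let ?F = "generate_field real_field {\<zeta>}"
  have F: "subfield ?F real_field" by (rule subfield_adjoin)
  have \<zeta>F: "\<zeta> \<in> ?F" by (rule generate_field.incl) simp
  obtain m where m: "is_min_poly m \<zeta>" using algebraic_int_ex_min_poly[OF ai] .
  then have m0: "m \<noteq> 0" by (auto simp: is_min_poly_def)
  obtain N where N: "0 < N" "\<And>i. of_nat N * poly.coeff m i \<in> \<int>"
    using common_denominator_poly[of m] by blast
  \<comment> \<open>Scaling by \<open>N\<close> makes the coefficients integers, so the recurrence
    sends integer sequences to integers.\<close>
  define p :: "real poly" where "p = map_poly of_rat (Polynomial.smult (of_nat N) m)"
  have "\<exists>k :: int. poly.coeff p i = of_int k" for i
  proof -
    obtain k where "of_nat N * poly.coeff m i = of_int k"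
      using N(2)[of i] by (auto elim: Ints_cases)
    then have "poly.coeff p i = of_int k" by (simp add: p_def coeff_map_poly)
    then show ?thesis by blast
  qed
  then obtain c :: "nat \<Rightarrow> int" where c: "\<And>i. poly.coeff p i = of_int (c i)" by metis
  have root: "poly p \<zeta> = 0" using m by (simp add: p_def hom_distribs is_min_poly_def)
  then obtain g where g: "p = [:-\<zeta>, 1:] * g" by (auto simp: poly_eq_0_iff_dvd)
  have p0: "p \<noteq> 0" using m0 N(1) by (auto simp: p_def)
  then have g0: "g \<noteq> 0" using g by auto
  have "rpoly (pderiv m) \<zeta> \<noteq> 0"
    using m irreducible_rpoly_simple_root[of m \<zeta>] by (auto simp: is_min_poly_def)
  then have "poly (pderiv p) \<zeta> \<noteq> 0"
    using N(1) by (simp add: p_def hom_distribs pderiv_smult)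
  then have g\<zeta>: "poly g \<zeta> \<noteq> 0" unfolding g pderiv_mult by simp
  define D where "D = Suc (Polynomial.degree g)"
  have degp: "Polynomial.degree p = D"
    unfolding g D_def using g0 by (subst degree_mult_eq) auto
  have coeff_p: "poly.coeff p i = (case i of 0 \<Rightarrow> 0 | Suc j \<Rightarrow> poly.coeff g j) - \<zeta> * poly.coeff g i" for i
    unfolding g by (simp add: coeff_pCons split: nat.splits)
  \<comment> \<open>Synthetic division from the top: each coefficient of \<open>g\<close> is an
    integer plus \<open>\<zeta>\<close> times the next higher one.\<close>
  have gF: "poly.coeff g i \<in> ?F" for i
  proof (cases "i \<le> D")
    case True
    then show ?thesis
    proof (induction rule: inc_induct)
      case base
      then show ?case using subfield_zero[OF F] by (simp add: D_def coeff_eq_0)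
    next
      case (step j)
      have "poly.coeff g j = of_int (c (Suc j)) + \<zeta> * poly.coeff g (Suc j)"
        using coeff_p[of "Suc j"] c[of "Suc j"] by simp
      also have "\<dots> \<in> ?F"
        using step \<zeta>F by (intro subfield_add subfield_mult subfield_of_int F)
      finally show ?case .
    qed
  next
    case False
    then show ?thesis using subfield_zero[OF F] by (simp add: D_def coeff_eq_0)
  qed
  define e where "e = (\<lambda>n. \<alpha> * \<zeta> ^ n - of_int (s n))"
  have e: "(\<lambda>n. e (n + i)) \<longlonglongrightarrow> 0" for i
    using LIMSEQ_ignore_initial_segment[OF s, of i] by (simp add: e_def)
  have s_eq: "of_int (s n) = \<alpha> * \<zeta> ^ n - e n" for n by (simp add: e_def)
  define u where "u = (\<lambda>n. \<Sum>i<D. poly.coeff g i * of_int (s (n + i)))"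
  \<comment> \<open>This is \<open>p = (X - \<zeta>) g\<close> with \<open>X\<close> acting on
    \<open>s\<close> as the shift.\<close>
  have rec: "u (Suc n) - \<zeta> * u n = of_int (\<Sum>i\<le>D. c i * s (n + i))" for n
  proof -
    have gD: "poly.coeff g D = 0" by (simp add: D_def coeff_eq_0)
    have "of_int (\<Sum>i\<le>D. c i * s (n + i)) = (\<Sum>i<Suc D. poly.coeff p i * of_int (s (n + i)))"
      by (simp add: c lessThan_Suc_atMost)
    also have "\<dots> = (\<Sum>i<Suc D. (case i of 0 \<Rightarrow> 0 | Suc j \<Rightarrow> poly.coeff g j) * of_int (s (n + i)))
        - (\<Sum>i<Suc D. \<zeta> * poly.coeff g i * of_int (s (n + i)))"
      by (simp only: coeff_p left_diff_distrib sum_subtractf)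
    also have "(\<Sum>i<Suc D. (case i of 0 \<Rightarrow> 0 | Suc j \<Rightarrow> poly.coeff g j) * of_int (s (n + i))) = u (Suc n)"
      by (subst sum.lessThan_Suc_shift) (simp add: u_def)
    also have "(\<Sum>i<Suc D. \<zeta> * poly.coeff g i * of_int (s (n + i))) = \<zeta> * u n"
      by (simp add: u_def gD sum_distrib_left mult_ac)
    finally show ?thesis by simp
  qed
  \<comment> \<open>Since \<open>p(\<zeta>) = 0\<close>, the recurrence kills the part
    \<open>\<alpha> * \<zeta> ^ n\<close>; only errors remain, so the integer values tend to
    \<open>0\<close>.\<close>
  have "(\<lambda>n. - (\<Sum>i\<le>D. of_int (c i) * e (n + i))) \<longlonglongrightarrow> - (\<Sum>i\<le>D. of_int (c i) * 0)"
    by (intro tendsto_intros e)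
  moreover have "- (\<Sum>i\<le>D. of_int (c i) * e (n + i)) = of_int (\<Sum>i\<le>D. c i * s (n + i))" for n
  proof -
    have "(\<Sum>i\<le>D. of_int (c i) * (\<alpha> * \<zeta> ^ (n + i))) = \<alpha> * \<zeta> ^ n * poly p \<zeta>"
      by (simp add: poly_altdef degp c sum_distrib_left power_add mult_ac)
    then show ?thesis
      by (simp add: s_eq right_diff_distrib sum_subtractf root)
  qed
  ultimately have "(\<lambda>n. real_of_int (\<Sum>i\<le>D. c i * s (n + i))) \<longlonglongrightarrow> 0" by simp
  from int_sequence_tendsto_zero[OF this]
  obtain n0 where n0: "\<And>n. n \<ge> n0 \<Longrightarrow> (\<Sum>i\<le>D. c i * s (n + i)) = 0"
    unfolding eventually_sequentially by blast
  have step: "u (Suc n) = \<zeta> * u n" if "n \<ge> n0" for n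
    using rec[of n] n0[OF that] by simp
  have geom: "u (n0 + k) = \<zeta> ^ k * u n0" for k
    by (induction k) (simp_all add: step)
  \<comment> \<open>After division by the power of \<open>\<zeta>\<close>, this vanishing sequence
    is constant in \<open>k\<close> because \<open>u\<close> is geometric; the constant is therefore
    \<open>0\<close>.\<close>
  have "(\<lambda>k. (1 / \<zeta>) ^ (k + n0) * (\<Sum>i<D. poly.coeff g i * e ((k + n0) + i)))
      \<longlonglongrightarrow> 0 * (\<Sum>i<D. poly.coeff g i * 0)"
  proof (intro tendsto_mult tendsto_sum tendsto_const)
    show "(\<lambda>k. (1 / \<zeta>) ^ (k + n0)) \<longlonglongrightarrow> 0"
      using gt1 by (intro LIMSEQ_ignore_initial_segment LIMSEQ_power_zero) simp
    show "(\<lambda>k. e (k + n0 + i)) \<longlonglongrightarrow> 0" for i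
      using e[of "n0 + i"] by (simp add: add.assoc)
  qed
  moreover have "(1 / \<zeta>) ^ (k + n0) * (\<Sum>i<D. poly.coeff g i * e ((k + n0) + i))
      = \<alpha> * poly g \<zeta> - u n0 / \<zeta> ^ n0" for k
  proof -
    let ?n = "k + n0"
    have "(\<Sum>i<D. poly.coeff g i * (\<alpha> * \<zeta> ^ (?n + i))) = \<alpha> * \<zeta> ^ ?n * poly g \<zeta>"
      by (simp add: poly_altdef D_def lessThan_Suc_atMost sum_distrib_left power_add mult_ac)
    then have "(\<Sum>i<D. poly.coeff g i * e (?n + i)) = \<alpha> * \<zeta> ^ ?n * poly g \<zeta> - u ?n"
      by (simp add: e_def u_def right_diff_distrib sum_subtractf)
    also have "u ?n = \<zeta> ^ k * u n0" using geom[of k] by (simp add: add.commute)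
    finally show ?thesis
      using gt1 by (simp add: field_simps power_add)
  qed
  ultimately have "(\<lambda>k :: nat. \<alpha> * poly g \<zeta> - u n0 / \<zeta> ^ n0) \<longlonglongrightarrow> 0" by simp
  then have "\<alpha> * poly g \<zeta> - u n0 / \<zeta> ^ n0 = 0" by (simp only: LIMSEQ_const_iff)
  then have "\<alpha> * poly g \<zeta> = u n0 / \<zeta> ^ n0" by simp
  then have "\<alpha> = u n0 / \<zeta> ^ n0 / poly g \<zeta>" using g\<zeta> by (metis nonzero_mult_div_cancel_right)
  also have "\<dots> \<in> ?F"
    unfolding u_def
    by (intro subfield_divide subfield_sum subfield_mult subfield_power subfield_of_int
        subfield_poly F gF \<zeta>F)
  finally show "\<alpha> \<in> ?F" .
qed

subsection \<open>Pisot generators of a real number field\<close>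

lemma norm_poly_diff_le:
  fixes a b :: "nat \<Rightarrow> 'a :: real_normed_field"
  assumes "\<And>i. i < d \<Longrightarrow> norm (a i - b i) \<le> \<epsilon>"
  shows "norm ((\<Sum>i<d. a i * z ^ i) - (\<Sum>i<d. b i * z ^ i)) \<le> \<epsilon> * (\<Sum>i<d. norm z ^ i)"
proof -
  have "(\<Sum>i<d. a i * z ^ i) - (\<Sum>i<d. b i * z ^ i) = (\<Sum>i<d. (a i - b i) * z ^ i)"
    by (simp add: left_diff_distrib sum_subtractf)
  also have "norm \<dots> \<le> (\<Sum>i<d. norm ((a i - b i) * z ^ i))" by (rule norm_sum)
  also have "\<dots> \<le> (\<Sum>i<d. \<epsilon> * norm z ^ i)"
    using assms by (intro sum_mono) (simp add: norm_mult norm_power mult_right_mono)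
  finally show ?thesis by (simp add: sum_distrib_left)
qed

text \<open>With \<open>m = (X - t) g\<close>, all conjugates of \<open>t\<close> other than \<open>t\<close> are roots of \<open>g\<close>. By Dirichlet's
  theorem some multiple \<open>Q g\<close> is close to a polynomial \<open>q\<close> with integer coefficients; then \<open>q\<close> is
  small at these conjugates, but not at \<open>t\<close>.\<close>

lemma ex_large_small_conjugates:
  fixes t :: real
  assumes m: "is_min_poly m t" and N: "0 < (N :: nat)"
  obtains q :: "int poly" where
    "1 < of_nat N * rpoly (map_poly of_int q) t"
    "\<And>z :: complex. rpoly m z = 0 \<Longrightarrow> z \<noteq> of_real t \<Longrightarrow>
       norm (of_nat N * rpoly (map_poly of_int q) z) < 1"
proof -
  have m0: "m \<noteq> 0" and root: "rpoly m t = 0" and irr: "Factorial_Ring.irreducible m"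
    using m by (auto simp: is_min_poly_def)
  obtain g where g: "map_poly of_rat m = [:-t, 1:] * g"
    using root by (auto simp: poly_eq_0_iff_dvd)
  have "poly (pderiv (map_poly of_rat m)) t \<noteq> 0"
    using irreducible_rpoly_simple_root[OF irr root] by (simp add: hom_distribs)
  then have gt: "poly g t \<noteq> 0" unfolding g pderiv_mult by simp
  define d where "d = Suc (Polynomial.degree g)"
  define R where "R = insert (of_real t) {z :: complex. rpoly m z = 0}"
  have "finite R" using m0 poly_roots_finite[of "map_poly of_rat m :: complex poly"] by (simp add: R_def)
  define C where "C = (\<Sum>z\<in>R. \<Sum>i<d. norm z ^ i)"
  have C: "(\<Sum>i<d. norm z ^ i) \<le> C" if "z \<in> R" for z
    unfolding C_def using \<open>finite R\<close> that by (intro member_le_sum) (auto intro: sum_nonneg)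
  have "(\<Sum>i<d. norm (of_real t :: complex) ^ i) \<ge> 0" by (intro sum_nonneg) auto
  with C[of "of_real t"] have C0: "0 \<le> C" by (simp add: R_def)
  \<comment> \<open>The value at \<open>t\<close> is pushed above \<open>2\<close> so that it stays
    above \<open>1\<close> after an error below \<open>1\<close>; \<open>M\<close> will be chosen to
    keep the error, scaled by \<open>L\<close>, that small on \<open>R\<close>.\<close>
  obtain k :: nat where k: "2 < of_nat k * \<bar>poly g t\<bar>"
    using gt reals_Archimedean3[of "\<bar>poly g t\<bar>"] by auto
  then have k0: "0 < k" by (intro gr0I) simp
  define L where "L = N * k"
  have L0: "0 < L" using N k0 by (simp add: L_def)
  have "of_nat k * \<bar>poly g t\<bar> \<le> of_nat L * \<bar>poly g t\<bar>"
    using N by (intro mult_right_mono) (simp_all add: L_def flip: of_nat_mult)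
  then have L: "2 < of_nat L * \<bar>poly g t\<bar>" using k by linarith
  obtain M :: nat where M: "of_nat L * C < of_nat M"
    using reals_Archimedean2 by blast
  have "0 \<le> of_nat L * C" using C0 by simp
  with M have M0: "0 < M" by (intro gr0I) auto
  obtain Q b where Q: "0 < Q" and b: "\<And>i. i < d \<Longrightarrow> \<bar>of_int Q * poly.coeff g i - of_int (b i)\<bar> < 1 / M"
    using Dirichlet_approx_simult[OF M0, of d "poly.coeff g"] by metis
  define q0 where "q0 = (\<Sum>i<d. Polynomial.monom (b i) i)"
  have q0: "rpoly (map_poly of_int q0) z = (\<Sum>i<d. of_int (b i) * z ^ i)" for z :: "'a :: field_char_0"
    by (simp add: q0_def map_poly_map_poly o_def of_int_hom.map_poly_hom_monom hom_distribs
        poly_sum poly_monom)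
  have close: "of_nat L * norm ((\<Sum>i<d. of_int (b i) * z ^ i)
      - (\<Sum>i<d. of_real (of_int Q * poly.coeff g i) * z ^ i)) < 1" if "z \<in> R" for z :: complex
  proof -
    have "norm ((\<Sum>i<d. of_int (b i) * z ^ i) - (\<Sum>i<d. of_real (of_int Q * poly.coeff g i) * z ^ i))
        \<le> 1 / M * (\<Sum>i<d. norm z ^ i)"
    proof (rule norm_poly_diff_le)
      fix i assume "i < d"
      have "norm (of_int (b i) - of_real (of_int Q * poly.coeff g i) :: complex)
          = norm (complex_of_real (of_int (b i) - of_int Q * poly.coeff g i))" by simp
      also have "\<dots> = \<bar>of_int (b i) - of_int Q * poly.coeff g i\<bar>" by (simp only: norm_of_real)
      also have "\<dots> \<le> 1 / M" using b[OF \<open>i < d\<close>] by linarith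
      finally show "norm (of_int (b i) - of_real (of_int Q * poly.coeff g i) :: complex) \<le> 1 / M" .
    qed
    also have "\<dots> \<le> 1 / M * C" using C[OF that] M0 by (intro mult_left_mono) auto
    finally have "of_nat L * norm ((\<Sum>i<d. of_int (b i) * z ^ i)
        - (\<Sum>i<d. of_real (of_int Q * poly.coeff g i) * z ^ i)) \<le> of_nat L * (1 / M * C)"
      using L0 by (intro mult_left_mono) auto
    also have "\<dots> < 1" using M M0 by (simp add: field_simps)
    finally show ?thesis .
  qed
  have poly_g: "(\<Sum>i<d. of_real (of_int Q * poly.coeff g i) * z ^ i)
      = of_int Q * poly (map_poly of_real g) z" for z :: complex
    by (simp add: poly_altdef d_def lessThan_Suc_atMost sum_distrib_left mult_ac coeff_map_poly)
  have small: "norm (of_nat L * rpoly (map_poly of_int q0) z) < 1"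
    if z: "rpoly m z = 0" "z \<noteq> of_real t" for z :: complex
  proof -
    have "map_poly of_rat m = (map_poly of_real (map_poly of_rat m :: real poly) :: complex poly)"
      by (simp add: map_poly_map_poly o_def of_real_of_rat)
    then have "rpoly m z = poly (map_poly of_real ([:-t, 1:] * g)) z"
      by (metis g)
    also have "\<dots> = (z - of_real t) * poly (map_poly of_real g) z"
      by (simp add: hom_distribs algebra_simps)
    finally have "rpoly m z = (z - of_real t) * poly (map_poly of_real g) z" .
    then have "poly (map_poly of_real g) z = 0" using z by simp
    then show ?thesis
      using close[of z] z unfolding poly_g by (simp add: q0 R_def norm_mult)
  qed
  have large: "1 < \<bar>of_nat L * rpoly (map_poly of_int q0) t\<bar>"
  proof -
    let ?q = "rpoly (map_poly of_int q0) t" and ?y = "of_int Q * poly g t"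
    have "poly (map_poly complex_of_real g) (of_real t) = of_real (poly g t)"
      by (rule of_real_hom.poly_map_poly)
    then have "(\<Sum>i<d. of_int (b i) * of_real t ^ i)
        - (\<Sum>i<d. of_real (of_int Q * poly.coeff g i) * of_real t ^ i) = complex_of_real (?q - ?y)"
      unfolding poly_g by (simp add: q0)
    then have "of_nat L * norm (complex_of_real (?q - ?y)) < 1"
      using close[of "of_real t"] by (simp add: R_def)
    then have "of_nat L * \<bar>?q - ?y\<bar> < 1" by (simp only: norm_of_real)
    then have "\<bar>of_nat L * ?q - of_nat L * ?y\<bar> < 1"
      by (simp add: abs_mult flip: right_diff_distrib)
    moreover have "2 < \<bar>of_nat L * ?y\<bar>"
    proof -
      have "1 * (of_nat L * \<bar>poly g t\<bar>) \<le> of_int Q * (of_nat L * \<bar>poly g t\<bar>)"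
        using Q by (intro mult_right_mono) auto
      also have "\<dots> = \<bar>of_nat L * ?y\<bar>" using Q by (simp add: abs_mult)
      finally show ?thesis using L by simp
    qed
    ultimately show ?thesis by linarith
  qed
  \<comment> \<open>The approximation does not control the sign at \<open>t\<close>, so it is
    adjusted here; \<open>k\<close> is absorbed into \<open>q\<close>, leaving exactly the
    prescribed factor \<open>N\<close>.\<close>
  define \<sigma> :: int where "\<sigma> = (if 0 \<le> rpoly (map_poly of_int q0) t then 1 else - 1)"
  define q where "q = Polynomial.smult (\<sigma> * int k) q0"
  have q: "of_nat N * rpoly (map_poly of_int q) z
      = of_int \<sigma> * (of_nat L * rpoly (map_poly of_int q0) z)" for z :: "'a :: field_char_0"
    by (simp add: q_def L_def hom_distribs mult_ac)
  show ?thesis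
  proof (rule that)
    show "1 < of_nat N * rpoly (map_poly of_int q) t"
      unfolding q using large by (auto simp: \<sigma>_def abs_mult)
    show "norm (of_nat N * rpoly (map_poly of_int q) z) < 1"
      if "rpoly m z = 0" "z \<noteq> of_real t" for z :: complex
      unfolding q using small[OF that] by (simp add: \<sigma>_def)
  qed
qed

text \<open>With \<open>\<zeta> = r(t)\<close>, the polynomial \<open>r\<close> has values of norm
  below \<open>1\<close> at the other conjugates of \<open>t\<close>. This bounds the other
  conjugates of \<open>\<zeta>\<close>, and it singles out \<open>t\<close> among the conjugates by
  \<open>r(t) > 1\<close>, so \<open>\<zeta>\<close> generates \<open>K\<close>.\<close>

lemma Pisot_generator_multiple:
  assumes t: "algebraic_int t" and K: "generate_field real_field {t} = K" and N: "0 < (N :: nat)"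
  obtains \<eta> where "algebraic_int \<eta>" "of_nat N * \<eta> \<in> Pisot_generators K"
proof -
  obtain m where m: "is_min_poly m t" using algebraic_int_ex_min_poly[OF t] .
  obtain q :: "int poly" where large: "1 < of_nat N * rpoly (map_poly of_int q) t"
    and small: "\<And>z :: complex. rpoly m z = 0 \<Longrightarrow> z \<noteq> of_real t \<Longrightarrow>
       norm (of_nat N * rpoly (map_poly of_int q) z) < 1"
    using ex_large_small_conjugates[OF m N] by blast
  define r where "r = Polynomial.smult (of_nat N) (map_poly of_int q :: rat poly)"
  have r: "rpoly r z = of_nat N * rpoly (map_poly of_int q) z" for z :: "'a :: field_char_0"
    by (simp add: r_def hom_distribs)
  define \<eta> where "\<eta> = rpoly (map_poly of_int q) t"
  define \<zeta> where "\<zeta> = of_nat N * \<eta>"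
  have \<zeta>: "\<zeta> = rpoly r t" by (simp add: \<zeta>_def \<eta>_def r)
  have gt1: "1 < \<zeta>" using large by (simp add: \<zeta>_def \<eta>_def)
  have \<eta>: "algebraic_int \<eta>"
    unfolding \<eta>_def
    by (rule algebraic_int_poly[OF _ t]) (simp add: map_poly_map_poly o_def coeff_map_poly)
  then have ai: "algebraic_int \<zeta>"
    unfolding \<zeta>_def by (intro algebraic_int_mult algebraic_int_of_nat)
  let ?F = "generate_field real_field {\<zeta>}"
  have F: "subfield ?F real_field" by (rule subfield_adjoin)
  have tF: "t \<in> ?F"
  proof (rule unique_common_root_in_subfield[OF F])
    let ?p = "map_poly of_rat m :: real poly" and ?q = "map_poly of_rat r - [:\<zeta>:] :: real poly"
    show "poly.coeff ?p i \<in> ?F" for i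
      by (simp add: coeff_map_poly subfield_of_rat[OF F])
    have "\<zeta> \<in> ?F" by (simp add: generate_field.incl)
    then show "poly.coeff ?q i \<in> ?F" for i
      by (auto simp: coeff_map_poly coeff_pCons split: nat.splits
          intro!: subfield_diff subfield_of_rat subfield_zero F)
    show "poly ?p t = 0" "poly ?q t = 0"
      using m by (simp_all add: is_min_poly_def \<zeta>)
    show "poly (pderiv ?p) t \<noteq> 0"
      using irreducible_rpoly_simple_root[of m t] m by (simp add: is_min_poly_def hom_distribs)
    fix z assume "poly (map_poly complex_of_real ?p) z = 0" "poly (map_poly complex_of_real ?q) z = 0"
    then have z: "rpoly m z = 0" "rpoly r z = of_real \<zeta>"
      by (simp_all add: hom_distribs map_poly_map_poly o_def of_real_of_rat)
    show "z = of_real t"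
    proof (rule ccontr)
      assume "z \<noteq> of_real t"
      from small[OF z(1) this] have "norm (of_real \<zeta> :: complex) < 1"
        using z(2) unfolding r by simp
      with gt1 show False by simp
    qed
  qed
  have "t \<in> K" using K by (auto intro: generate_field.incl)
  have subK: "subfield K real_field" using K subfield_adjoin by blast
  have "\<zeta> \<in> K" unfolding \<zeta> by (rule subfield_rpoly[OF subK \<open>t \<in> K\<close>])
  then have FK: "?F = K"
    using adjoin_least[OF subK] adjoin_least[OF F tF] K by auto
  obtain p where p: "is_min_poly p \<zeta>" using algebraic_int_ex_min_poly[OF ai] .
  obtain s where s: "t = rpoly s \<zeta>" using tF generate_field_rpoly[OF p] by auto
  have "norm z < 1" if z: "z \<in> conjugates \<zeta> - {of_real \<zeta>}" for z
  proof -
    obtain p where p: "is_min_poly p \<zeta>" "rpoly p z = 0"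
      using z by (auto simp: conjugates_def)
    \<comment> \<open>Two relations pass from \<open>\<zeta>\<close> to its conjugate
      \<open>z\<close>: \<open>m(s(z)) = 0\<close>, so \<open>s(z)\<close> is a conjugate of
      \<open>t\<close>, and \<open>r(s(z)) = z\<close>.\<close>
    have "rpoly (pcompose m s) \<zeta> = 0"
      using m by (simp add: rpoly_pcompose is_min_poly_def flip: s)
    from rpoly_dvd[OF is_min_poly_dvd[OF p(1) this] p(2)]
    have mz: "rpoly m (rpoly s z) = 0" by (simp add: rpoly_pcompose)
    have "rpoly (pcompose r s - [:0, 1:]) \<zeta> = 0"
      by (simp add: rpoly_diff rpoly_pcompose rpoly_X flip: s \<zeta>)
    from rpoly_dvd[OF is_min_poly_dvd[OF p(1) this] p(2)]
    have rz: "rpoly r (rpoly s z) = z" by (simp add: rpoly_diff rpoly_pcompose rpoly_X)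
    have "rpoly s z \<noteq> of_real t"
    proof
      assume "rpoly s z = of_real t"
      then have "z = of_real \<zeta>" using rz by (simp add: rpoly_of_real \<zeta>)
      with z show False by simp
    qed
    from small[OF mz this] show ?thesis using rz by (simp flip: r)
  qed
  then have "\<zeta> \<in> Pisot_generators K"
    using ai gt1 FK by (simp add: Pisot_generators_def Pisot_def)
  with \<eta> show ?thesis using that by (simp add: \<zeta>_def)
qed

subsection \<open>Rational integers as Pisot numbers\<close>

lemma of_nat_Pisot:
  assumes "1 < k"
  shows "of_nat k \<in> Pisot"
proof -
  have "z = of_nat k" if z: "z \<in> conjugates (of_nat k)" for z
  proof -
    obtain p where p: "is_min_poly p (of_nat k :: real)" "rpoly p z = 0"
      using z by (auto simp: conjugates_def)
    have "rpoly [:- of_nat k, 1:] (of_nat k :: real) = 0" by (simp add: hom_distribs)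
    from rpoly_dvd[OF is_min_poly_dvd[OF p(1) this] p(2)]
    show ?thesis by (simp add: hom_distribs)
  qed
  then show ?thesis using assms by (auto simp: Pisot_def algebraic_int_of_nat)
qed

text \<open>The approximating integers eventually satisfy \<open>s (Suc n) = k * s n\<close>, so
  from then on the error is multiplied by \<open>k\<close> at each step; tending to
  \<open>0\<close>, it must already be \<open>0\<close>.\<close>

lemma M_set_of_nat:
  assumes "1 < k" "\<alpha> \<in> M_set (of_nat k)"
  obtains n where "\<alpha> * of_nat k ^ n \<in> \<int>"
proof -
  obtain s :: "nat \<Rightarrow> int" where s: "(\<lambda>n. \<alpha> * of_nat k ^ n - of_int (s n)) \<longlonglongrightarrow> 0"
    using assms(2) unfolding M_set_iff by blast
  have "(\<lambda>n. of_nat k * (\<alpha> * of_nat k ^ n - of_int (s n)) - (\<alpha> * of_nat k ^ Suc n - of_int (s (Suc n))))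
      \<longlonglongrightarrow> of_nat k * 0 - 0"
    by (intro tendsto_intros s LIMSEQ_Suc[OF s])
  then have "(\<lambda>n. real_of_int (s (Suc n) - int k * s n)) \<longlonglongrightarrow> 0"
    by (simp add: algebra_simps)
  from int_sequence_tendsto_zero[OF this]
  obtain n0 where n0: "\<And>n. n \<ge> n0 \<Longrightarrow> s (Suc n) = int k * s n"
    unfolding eventually_sequentially by auto
  define e where "e = \<alpha> * of_nat k ^ n0 - of_int (s n0)"
  have geom: "\<alpha> * of_nat k ^ (n0 + j) - of_int (s (n0 + j)) = of_nat k ^ j * e" for j
  proof (induction j)
    case (Suc j)
    have "\<alpha> * of_nat k ^ (n0 + Suc j) - of_int (s (n0 + Suc j))
        = of_nat k * (\<alpha> * of_nat k ^ (n0 + j) - of_int (s (n0 + j)))"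
      by (simp add: n0 right_diff_distrib mult_ac)
    then show ?case by (simp add: Suc)
  qed (simp add: e_def)
  have "(\<lambda>j. of_nat k ^ j * e) \<longlonglongrightarrow> 0"
    using LIMSEQ_ignore_initial_segment[OF s, of n0] unfolding geom[symmetric] by (simp add: add.commute)
  then have "(\<lambda>j. inverse (of_nat k ^ j) * (of_nat k ^ j * e)) \<longlonglongrightarrow> 0 * 0"
    using assms(1) by (intro tendsto_mult LIMSEQ_inverse_realpow_zero) auto
  moreover have "inverse (of_nat k ^ j) * (of_nat k ^ j * e) = e" for j
    using assms(1) by simp
  ultimately have "(\<lambda>j :: nat. e) \<longlonglongrightarrow> 0" by simp
  then have "e = 0" by (simp only: LIMSEQ_const_iff)
  then have "\<alpha> * of_nat k ^ n0 = of_int (s n0)" by (simp add: e_def)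
  then show ?thesis using that by (metis Ints_of_int)
qed

text \<open>Both a power of \<open>2\<close> and a power of \<open>3\<close> are denominators of
  \<open>\<alpha>\<close>, and these are coprime.\<close>

lemma M_set_two_three:
  assumes "\<alpha> \<in> M_set 2" "\<alpha> \<in> M_set 3"
  shows "\<alpha> \<in> \<int>"
proof -
  obtain i where "\<alpha> * 2 ^ i \<in> \<int>"
    using M_set_of_nat[of 2 \<alpha>] assms(1) by auto
  then obtain a where a: "\<alpha> * 2 ^ i = of_int a"
    by (rule Ints_cases)
  obtain j where "\<alpha> * 3 ^ j \<in> \<int>"
    using M_set_of_nat[of 3 \<alpha>] assms(2) by auto
  then obtain b where b: "\<alpha> * 3 ^ j = of_int b"
    by (rule Ints_cases)
  have "real_of_int (a * 3 ^ j) = \<alpha> * 2 ^ i * 3 ^ j" by (simp add: a)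
  also have "\<dots> = \<alpha> * 3 ^ j * 2 ^ i" by (simp only: mult_ac)
  also have "\<dots> = of_int (b * 2 ^ i)" by (simp add: b)
  finally have "real_of_int (a * 3 ^ j) = of_int (b * 2 ^ i)" .
  then have "a * 3 ^ j = b * 2 ^ i" by (simp only: of_int_eq_iff)
  then have "2 ^ i dvd a * 3 ^ j" by simp
  moreover have "Rings.coprime (2 ^ i) (3 ^ j :: int)" by simp
  ultimately have "2 ^ i dvd a" by (simp add: coprime_dvd_mult_left_iff)
  then obtain c where "a = 2 ^ i * c" ..
  with a have "\<alpha> = of_int c" by simp
  then show ?thesis by simp
qed

section \<open>The chain of inclusions for a real number field\<close>

theorem theorem3p27:
  fixes K :: "real set"
  assumes "real_number_field K" and "K \<noteq> \<rat>"
  shows "(\<Inter>\<zeta> \<in> Pisot \<inter> K. M_set \<zeta>) = \<int>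
    \<and> \<int> \<subset> ring_of_integers K
    \<and> ring_of_integers K \<subseteq> (\<Inter>\<zeta> \<in> Pisot_generators K. M_set \<zeta>)
    \<and> (\<Inter>\<zeta> \<in> Pisot_generators K. M_set \<zeta>) \<subset> (\<Union>\<zeta> \<in> Pisot_generators K. M_set \<zeta>)
    \<and> (\<Union>\<zeta> \<in> Pisot_generators K. M_set \<zeta>) = (\<Union>\<zeta> \<in> Pisot \<inter> K. M_set \<zeta>)
    \<and> (\<Union>\<zeta> \<in> Pisot \<inter> K. M_set \<zeta>) = K"
proof -
  have K: "subfield K real_field" using assms(1) by (simp add: real_number_field_def)
  have Ints_K: "\<int> \<subseteq> K" using subfield_of_int[OF K] by (auto elim!: Ints_cases)
  obtain t where t: "algebraic_int t" "generate_field real_field {t} = K"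
    using real_number_field_primitive_element[OF assms(1)] .
  have gen_sub: "Pisot_generators K \<subseteq> Pisot \<inter> K"
    by (auto simp: Pisot_generators_def intro: generate_field.incl)

  have "\<int> \<subseteq> M_set \<zeta>" if "\<zeta> \<in> Pisot" for \<zeta>
    using Pisot_algebraic_int_in_M_set[OF that] subfield_of_int[OF subfield_adjoin]
    by (auto elim!: Ints_cases simp: algebraic_int_of_int)
  moreover have "2 \<in> Pisot \<inter> K" "3 \<in> Pisot \<inter> K"
    using of_nat_Pisot[of 2] of_nat_Pisot[of 3] subfield_of_nat[OF K, of 2] subfield_of_nat[OF K, of 3]
    by simp_all
  ultimately have inter: "(\<Inter>\<zeta> \<in> Pisot \<inter> K. M_set \<zeta>) = \<int>"
    by (intro equalityI subsetI INT_I) (meson INT_E M_set_two_three, meson IntD1 subsetD)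

  have ints: "\<int> \<subset> ring_of_integers K"
  proof
    show "\<int> \<subseteq> ring_of_integers K"
      using Ints_K by (auto simp: ring_of_integers_def int_imp_algebraic_int)
    show "\<int> \<noteq> ring_of_integers K"
    proof
      assume eq: "\<int> = ring_of_integers K"
      \<comment> \<open>Every element of \<open>K\<close> is a quotient of an algebraic integer of
        \<open>K\<close> by a positive integer, so equality would make \<open>K\<close>
        rational.\<close>
      have "x \<in> \<rat>" if x: "x \<in> K" for x
      proof -
        obtain N :: nat where N: "0 < N" "algebraic_int (of_nat N * x)"
          using real_number_field_multiple_algebraic_int[OF assms(1) x] .
        then have "of_nat N * x \<in> ring_of_integers K"
          using x by (simp add: ring_of_integers_def subfield_mult[OF K] subfield_of_nat[OF K])
        then have "of_nat N * x / of_nat N \<in> \<rat>"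
          unfolding eq[symmetric] using Ints_subset_Rats by (intro Rats_divide) auto
        then show ?thesis using N(1) by simp
      qed
      moreover have "\<rat> \<subseteq> K" using subfield_of_rat[OF K] by (auto elim!: Rats_cases)
      ultimately show False using assms(2) by blast
    qed
  qed
  have ring: "ring_of_integers K \<subseteq> (\<Inter>\<zeta> \<in> Pisot_generators K. M_set \<zeta>)"
    using Pisot_algebraic_int_in_M_set by (auto simp: ring_of_integers_def Pisot_generators_def)
  have sub: "(\<Union>\<zeta> \<in> Pisot \<inter> K. M_set \<zeta>) \<subseteq> K"
  proof (rule UN_least)
    fix \<zeta> assume "\<zeta> \<in> Pisot \<inter> K"
    then show "M_set \<zeta> \<subseteq> K"
      using M_set_subset_adjoin[of \<zeta>] adjoin_least[OF K, of \<zeta>] by (auto simp: Pisot_def)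
  qed
  have sup: "K \<subseteq> (\<Union>\<zeta> \<in> Pisot_generators K. M_set \<zeta>)"
  proof
    fix \<alpha> assume \<alpha>: "\<alpha> \<in> K"
    obtain N :: nat where N: "0 < N" "algebraic_int (of_nat N * \<alpha>)"
      using real_number_field_multiple_algebraic_int[OF assms(1) \<alpha>] .
    obtain \<eta> where \<eta>: "algebraic_int \<eta>" "of_nat N * \<eta> \<in> Pisot_generators K"
      using Pisot_generator_multiple[OF t N(1)] .
    let ?\<zeta> = "of_nat N * \<eta>"
    have "algebraic_int (of_nat N * \<alpha> * \<eta>)" by (rule algebraic_int_mult[OF N(2) \<eta>(1)])
    then have "algebraic_int (\<alpha> * ?\<zeta>)" by (simp add: mult_ac)
    moreover have "\<alpha> * ?\<zeta> \<in> K" using \<alpha> \<eta>(2) gen_sub by (auto intro: subfield_mult[OF K])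
    ultimately have "\<alpha> * ?\<zeta> \<in> M_set ?\<zeta>"
      using \<eta>(2) by (intro Pisot_algebraic_int_in_M_set) (auto simp: Pisot_generators_def)
    then have "\<alpha> \<in> M_set ?\<zeta>" by (rule M_set_shift)
    then show "\<alpha> \<in> (\<Union>\<zeta> \<in> Pisot_generators K. M_set \<zeta>)" using \<eta>(2) by blast
  qed
  have strict: "(\<Inter>\<zeta> \<in> Pisot_generators K. M_set \<zeta>) \<subset> (\<Union>\<zeta> \<in> Pisot_generators K. M_set \<zeta>)"
  proof -
    \<comment> \<open>The case \<open>N = 1\<close> shows that the family is nonempty, without which
      the intersection would be the whole real line.\<close>
    obtain \<zeta> where \<zeta>: "\<zeta> \<in> Pisot_generators K"
      using Pisot_generator_multiple[OF t, of 1] by auto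
    then obtain N :: nat where N: "0 < N" "1 / of_nat N \<notin> M_set \<zeta>"
      using Pisot_inverse_nat_not_in_M_set gen_sub by blast
    have "1 / of_nat N \<in> K"
      by (intro subfield_divide subfield_one subfield_of_nat K)
    then have "1 / of_nat N \<in> (\<Union>\<zeta> \<in> Pisot_generators K. M_set \<zeta>)"
      using sup by (rule subsetD[rotated])
    moreover have "1 / of_nat N \<notin> (\<Inter>\<zeta> \<in> Pisot_generators K. M_set \<zeta>)"
      using \<zeta> N(2) by blast
    moreover have "(\<Inter>\<zeta> \<in> Pisot_generators K. M_set \<zeta>) \<subseteq> (\<Union>\<zeta> \<in> Pisot_generators K. M_set \<zeta>)"
      using \<zeta> by blast
    ultimately show ?thesis by blast
  qed
  have "(\<Union>\<zeta> \<in> Pisot_generators K. M_set \<zeta>) \<subseteq> (\<Union>\<zeta> \<in> Pisot \<inter> K. M_set \<zeta>)"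
    using gen_sub by (intro UN_mono) auto
  with sub sup have "(\<Union>\<zeta> \<in> Pisot_generators K. M_set \<zeta>) = (\<Union>\<zeta> \<in> Pisot \<inter> K. M_set \<zeta>)"
    "(\<Union>\<zeta> \<in> Pisot \<inter> K. M_set \<zeta>) = K"
    by order+
  with inter ints ring strict show ?thesis by (intro conjI)
qed

end
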